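(* If $G$ is a finite minimal PF-group, then $G$ is solvable.
   Context: All groups are finite. A non-trivial partition of a group $G$ is a collection $\{H_1,\dots,H_r\}$ of non-identity subgroups of $G$ with $r>1$ such that every non-identity element of $G$ belongs to one and only one $H_i$. A PF-group (partition-free group) is a non-cyclic group that does not admit a non-trivial partition. A minimal PF-group is a PF-group all of whose proper non-cyclic subgroups admit non-trivial partitions. *)

theory Defs
  imports "HOL-Algebra.Algebra"
begin

(* The index r > 1 is the cardinality of P: a family H_1, ..., H_r as below has no repetitions,
   since its members are non-trivial and no non-identity element lies in two of them. *)
definition nontrivial_partition :: "('a, 'b) monoid_scheme \<Rightarrow> 'a set set \<Rightarrow> bool" where
  "nontrivial_partition G P \<longleftrightarrow>
     card P > 1 \<and>
     (\<forall>H\<in>P. subgroup H G \<and> H \<noteq> {\<one>\<^bsub>G\<^esub>}) \<and>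
     (\<forall>x\<in>carrier G. x \<noteq> \<one>\<^bsub>G\<^esub> \<longrightarrow> (\<exists>!H. H \<in> P \<and> x \<in> H))"

definition admits_nontrivial_partition :: "('a, 'b) monoid_scheme \<Rightarrow> bool" where
  "admits_nontrivial_partition G \<longleftrightarrow> (\<exists>P. nontrivial_partition G P)"

definition PF_group :: "('a, 'b) monoid_scheme \<Rightarrow> bool" where
  "PF_group G \<longleftrightarrow> group G \<and> \<not> cyclic_group G \<and> \<not> admits_nontrivial_partition G"

definition minimal_PF_group :: "('a, 'b) monoid_scheme \<Rightarrow> bool" where
  "minimal_PF_group G \<longleftrightarrow>
     PF_group G \<and>
     (\<forall>H. subgroup H G \<and> H \<noteq> carrier G \<and> \<not> cyclic_group (G\<lparr>carrier := H\<rparr>) \<longrightarrow>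
          admits_nontrivial_partition (G\<lparr>carrier := H\<rparr>))"

end

theory Submission
  imports Defs "HOL-Number_Theory.Residues"
begin

text \<open>
Assume that \<open>G\<close> is a minimal PF-group and not solvable.

In a non-cyclic group the maximal cyclic subgroups form a non-trivial partition as soon as distinct ones
meet trivially. So \<open>G\<close> has two distinct maximal cyclic subgroups \<open>A\<close> and \<open>B\<close> with a common element
\<open>x \<noteq> \<one>\<close>. If they generated a proper subgroup, that subgroup would be non-cyclic, hence partitioned, and the
component of \<open>x\<close> would contain \<open>A\<close> and \<open>B\<close>, which is absurd (\<open>maximal_cyclic_join\<close>). So \<open>A\<close> and \<open>B\<close> generate
\<open>G\<close>, and a power \<open>z\<close> of \<open>x\<close> of prime order \<open>p\<close> is central.

In a partitioned group containing \<open>z\<close>, an element \<open>y\<close> outside the component of \<open>z\<close> satisfies \<open>y^p = \<one>\<close>: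
otherwise \<open>y\<close> and \<open>y z\<close>, having the same \<open>p\<close>-th power, would lie in one component together with \<open>z\<close>.
Descending through components, every proper subgroup \<open>M\<close> containing \<open>z\<close> has a cyclic core: a
cyclic subgroup containing \<open>z\<close> outside which \<open>y^p = \<one>\<close> (\<open>partition_imp_core\<close>). The whole group has no core,
because such a core would contain both \<open>A\<close> and \<open>B\<close>. This is the situation of the locale \<open>cored_group\<close>,
and everything that follows takes place in it.

Cores applied to centralizers show that \<open>\<langle>z\<rangle>\<close> is the whole center \<open>Z\<close>, that the centralizer of \<open>a\<close> is cyclic
when \<open>a^p \<noteq> \<one>\<close>, and that it has exponent \<open>p\<close> when \<open>a\<close> is non-central with \<open>a^p = \<one>\<close>. The
cyclic centralizers and the maximal subgroups of exponent \<open>p\<close> are called blocks here: they cover \<open>G\<close>, meet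
pairwise in \<open>Z\<close>, and are permuted by conjugation. Therefore the conjugates of a block \<open>X\<close> with \<open>|X| = n |Z|\<close>
and \<open>|N(X)| = e |X|\<close> fill, apart from \<open>Z\<close>, the proportion \<open>(1 - 1/n)/e\<close> of \<open>G\<close> (\<open>weight_index\<close>), and over all classes
these weights add up to \<open>1 - |Z|/|G|\<close>. It is the equation that governs the finite rotation groups.

A block with \<open>e = 1\<close> has weight at least \<open>1/2\<close>, so not all blocks are self-normalizing. For cyclic blocks \<open>e\<close> is \<open>1\<close>
or \<open>p\<close>; this comes from inversion for \<open>p = 2\<close>, and for odd \<open>p\<close> from the action on a subgroup of prime order
different from \<open>p\<close>. The blocks of exponent \<open>p\<close> are self-normalizing for odd \<open>p\<close>, while for \<open>p = 2\<close> their
only other option is order \<open>4\<close> inside a normalizer of order \<open>8\<close>. With this information the weight equation has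
no solution (\<open>even_contradiction\<close>, \<open>odd_contradiction\<close>), once blocks that are normal in \<open>G\<close> are ruled out.
Non-solvability enters by excluding abelian groups and \<open>p\<close>-groups, and by the fact that a solvable normal
subgroup and one further element never generate \<open>G\<close>.
\<close>

(* From here on prime is the predicate on natural numbers. *)
hide_const (open) Divisibility.prime

section \<open>Conjugation, centralizers and cyclic subgroups\<close>

context group
begin

definition conj_by :: "'a \<Rightarrow> 'a \<Rightarrow> 'a" where
  "conj_by g x = g \<otimes> x \<otimes> inv g"

definition centralizer :: "'a \<Rightarrow> 'a set" where
  "centralizer x = {g \<in> carrier G. g \<otimes> x = x \<otimes> g}"

abbreviation cyc :: "'a \<Rightarrow> 'a set" where
  "cyc a \<equiv> generate G {a}"

text \<open>
For \<open>c\<close> normalizing \<open>D\<close> this is the subgroup generated by \<open>D\<close> and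
\<open>c\<close>; in a finite group non-negative powers suffice.
\<close>
definition adjoin :: "'a set \<Rightarrow> 'a \<Rightarrow> 'a set" where
  "adjoin D c = {d \<otimes> c [^] (n::nat) | d n. d \<in> D}"

lemma inv_cancel_left:
  assumes "x \<in> carrier G" "y \<in> carrier G"
  shows "inv x \<otimes> (x \<otimes> y) = y" "x \<otimes> (inv x \<otimes> y) = y"
  using assms by (metis inv_closed l_inv l_one m_assoc, metis inv_closed r_inv l_one m_assoc)

lemmas word_simps = m_assoc inv_mult_group inv_cancel_left

lemma conj_by_closed [simp]: "g \<in> carrier G \<Longrightarrow> x \<in> carrier G \<Longrightarrow> conj_by g x \<in> carrier G"
  by (simp add: conj_by_def)

lemma conj_by_mult: "g \<in> carrier G \<Longrightarrow> x \<in> carrier G \<Longrightarrow> y \<in> carrier G \<Longrightarrow> conj_by g (x \<otimes> y) = conj_by g x \<otimes> conj_by g y"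
  by (simp add: conj_by_def word_simps)

lemma conj_by_conj_by: "g \<in> carrier G \<Longrightarrow> h \<in> carrier G \<Longrightarrow> x \<in> carrier G \<Longrightarrow> conj_by g (conj_by h x) = conj_by (g \<otimes> h) x"
  by (simp add: conj_by_def word_simps)

lemma conj_by_one [simp]: "g \<in> carrier G \<Longrightarrow> conj_by g \<one> = \<one>" "x \<in> carrier G \<Longrightarrow> conj_by \<one> x = x"
  by (simp_all add: conj_by_def)

lemma conj_by_inv_left [simp]:
  "g \<in> carrier G \<Longrightarrow> x \<in> carrier G \<Longrightarrow> conj_by (inv g) (conj_by g x) = x"
  "g \<in> carrier G \<Longrightarrow> x \<in> carrier G \<Longrightarrow> conj_by g (conj_by (inv g) x) = x"
  by (simp_all add: conj_by_conj_by)

lemma conj_by_inv: "g \<in> carrier G \<Longrightarrow> x \<in> carrier G \<Longrightarrow> conj_by g (inv x) = inv (conj_by g x)"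
  by (simp add: conj_by_def word_simps)

lemma conj_by_pow: "g \<in> carrier G \<Longrightarrow> x \<in> carrier G \<Longrightarrow> conj_by g (x [^] (n::nat)) = conj_by g x [^] n"
  by (induction n) (simp_all add: conj_by_mult)

lemma inj_on_conj_by: "g \<in> carrier G \<Longrightarrow> inj_on (conj_by g) (carrier G)"
  by (metis conj_by_inv_left(1) inj_onI)

lemma conj_by_fixes_iff: "g \<in> carrier G \<Longrightarrow> x \<in> carrier G \<Longrightarrow> conj_by g x = x \<longleftrightarrow> g \<otimes> x = x \<otimes> g"
  unfolding conj_by_def by (metis inv_solve_right m_closed)

lemma conj_by_image_conj_by: "g \<in> carrier G \<Longrightarrow> h \<in> carrier G \<Longrightarrow> S \<subseteq> carrier G \<Longrightarrow> conj_by g ` conj_by h ` S = conj_by (g \<otimes> h) ` S"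
  unfolding image_image by (rule image_cong) (auto simp: conj_by_conj_by)

lemma conj_by_image_one: "S \<subseteq> carrier G \<Longrightarrow> conj_by \<one> ` S = S"
  by (force simp: image_def)

lemma conj_by_image_inv: "g \<in> carrier G \<Longrightarrow> S \<subseteq> carrier G \<Longrightarrow> conj_by g ` S = Y \<Longrightarrow> conj_by (inv g) ` Y = S"
  using conj_by_image_conj_by[of "inv g" g S] conj_by_image_one by simp

lemma conj_by_image_carrier: "g \<in> carrier G \<Longrightarrow> S \<subseteq> carrier G \<Longrightarrow> conj_by g ` S \<subseteq> carrier G"
  by auto

lemma subgroup_conj_by_image: "g \<in> carrier G \<Longrightarrow> subgroup H G \<Longrightarrow> subgroup (conj_by g ` H) G"
  by (intro subgroupI)
     (auto simp: subgroup.mem_carrier conj_by_mult[symmetric] conj_by_inv[symmetric] subgroup.m_closed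
        subgroup.m_inv_closed subgroup.one_closed intro!: imageI dest: subgroup.one_closed)

lemma card_conj_by_image: "g \<in> carrier G \<Longrightarrow> S \<subseteq> carrier G \<Longrightarrow> card (conj_by g ` S) = card S"
  by (meson card_image inj_on_conj_by inj_on_subset)

lemma conj_by_coset: "g <# S #> inv g = conj_by g ` S"
  unfolding l_coset_def r_coset_def conj_by_def by auto

lemma normalizer_eq: "S \<subseteq> carrier G \<Longrightarrow> normalizer G S = {g \<in> carrier G. conj_by g ` S = S}"
  unfolding normalizer_def stabilizer_def by (simp add: conj_by_coset)

lemma subgroup_centralizer: "x \<in> carrier G \<Longrightarrow> subgroup (centralizer x) G"
proof (rule subgroupI)
  fix a b assume x: "x \<in> carrier G" and "a \<in> centralizer x"
  then have a: "a \<in> carrier G" "a \<otimes> x = x \<otimes> a" by (auto simp: centralizer_def)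
  then have "inv a \<otimes> (a \<otimes> x) \<otimes> inv a = inv a \<otimes> (x \<otimes> a) \<otimes> inv a" by simp
  then have "x \<otimes> inv a = inv a \<otimes> x" using a(1) x by (simp add: word_simps)
  then show "inv a \<in> centralizer x" using a x by (simp add: centralizer_def)
  assume "b \<in> centralizer x"
  with a x show "a \<otimes> b \<in> centralizer x" by (auto simp: centralizer_def) (metis m_assoc)
qed (auto simp: centralizer_def)

lemma centralizer_memD: "y \<in> centralizer x \<Longrightarrow> y \<in> carrier G" "y \<in> centralizer x \<Longrightarrow> y \<otimes> x = x \<otimes> y"
  by (auto simp: centralizer_def)

lemma centralizer_sym: "x \<in> carrier G \<Longrightarrow> y \<in> centralizer x \<Longrightarrow> x \<in> centralizer y"
  by (auto simp: centralizer_def)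

lemma centralizer_self: "x \<in> carrier G \<Longrightarrow> x \<in> centralizer x"
  by (auto simp: centralizer_def)

lemma centralizer_conj_by: 
  assumes "g \<in> carrier G" "x \<in> carrier G" 
  shows "centralizer (conj_by g x) = conj_by g ` centralizer x"
proof -
  have *: "conj_by g ` centralizer x \<subseteq> centralizer (conj_by g x)" if "g \<in> carrier G" "x \<in> carrier G" for g x
    using that by (auto simp: centralizer_def conj_by_mult[symmetric])
  have "centralizer (conj_by g x) = conj_by g ` conj_by (inv g) ` centralizer (conj_by g x)"
    using assms conj_by_image_conj_by[of g "inv g"] conj_by_image_one by (simp add: subgroup.subset subgroup_centralizer)
  also have "\<dots> \<subseteq> conj_by g ` centralizer x"
    using *[of "inv g" "conj_by g x"] assms by auto
  finally show ?thesis using *[OF assms] by auto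
qed

lemma subgroup_nat_pow_closed: "subgroup H G \<Longrightarrow> x \<in> H \<Longrightarrow> x [^] (n::nat) \<in> H"
  by (induction n) (auto simp: subgroup.one_closed subgroup.m_closed)

lemma cyc_subgroup: "a \<in> carrier G \<Longrightarrow> subgroup (cyc a) G"
  by (simp add: generate_is_subgroup)

lemma cyc_self: "a \<in> cyc a"
  by (simp add: generate.incl)

lemma cyc_least: "subgroup H G \<Longrightarrow> a \<in> H \<Longrightarrow> cyc a \<subseteq> H"
  by (simp add: generate_subgroup_incl)

lemma cyc_commute: 
  assumes "a \<in> carrier G" "x \<in> cyc a" "y \<in> cyc a" shows "x \<otimes> y = y \<otimes> x"
proof -
  have "cyc a \<subseteq> centralizer a" using assms by (simp add: cyc_least subgroup_centralizer centralizer_self)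
  then have "a \<in> centralizer x" using assms centralizer_sym by blast
  then have "cyc a \<subseteq> centralizer x" using assms(2) cyc_least subgroup_centralizer generate_in_carrier assms(1) by (metis empty_subsetI insert_subset)
  with assms show ?thesis by (auto simp: centralizer_def)
qed

lemma mult_not_in_subgroup:
  assumes "subgroup H G" "y \<in> carrier G" "y \<notin> H" "x \<in> H"
  shows "y \<otimes> x \<notin> H" "x \<otimes> y \<notin> H"
proof -
  have x: "inv x \<in> H" "x \<in> carrier G"
    using assms by (auto simp: subgroup.m_inv_closed subgroup.mem_carrier)
  show "y \<otimes> x \<notin> H"
  proof
    assume "y \<otimes> x \<in> H"
    then have "y \<otimes> x \<otimes> inv x \<in> H" using x(1) subgroup.m_closed[OF assms(1)] by blast
    then show False using assms(2,3) x(2) by (simp add: m_assoc)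
  qed
  show "x \<otimes> y \<notin> H"
  proof
    assume "x \<otimes> y \<in> H"
    then have "inv x \<otimes> (x \<otimes> y) \<in> H" using x(1) subgroup.m_closed[OF assms(1)] by blast
    then show False using assms(2,3) x(2) by (simp add: inv_cancel_left)
  qed
qed

lemma pow_mult_commute:
  assumes "x \<in> carrier G" "y \<in> carrier G" "x \<otimes> y = y \<otimes> x"
  shows "(x \<otimes> y) [^] (n::nat) = x [^] n \<otimes> y [^] n"
  using assms pow_mult_distrib by blast

end

locale finite_group = group +
  assumes fin: "finite (carrier G)"
begin

lemma finite_sub: "S \<subseteq> carrier G \<Longrightarrow> finite S"
  using fin finite_subset by blast

lemma cyc_nat: "a \<in> carrier G \<Longrightarrow> cyc a = {a [^] n | n. n \<in> (UNIV :: nat set)}"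
  using generate_pow_on_finite_carrier[OF fin] by blast

lemma finite_subgroupI:
  assumes "H \<subseteq> carrier G" "H \<noteq> {}" "\<And>x y. x \<in> H \<Longrightarrow> y \<in> H \<Longrightarrow> x \<otimes> y \<in> H"
  shows "subgroup H G"
proof (rule subgroupI)
  fix a assume a: "a \<in> H"
  then have aG: "a \<in> carrier G" using assms by auto
  have pow: "a [^] Suc n \<in> H" for n :: nat 
    by (induction n) (use a aG assms in auto)
  \<comment> \<open>The exponent \<open>2 * ord a - 1\<close>, unlike \<open>ord a - 1\<close>, is positive even for \<open>a = \<one>\<close>, so that closure under products applies.\<close>
  have "inv a = a [^] (2 * ord a - 1)"
  proof (rule inv_equality)
    have "ord a \<ge> 1" using ord_ge_1[OF fin aG] .
    then have "a [^] (2 * ord a - 1) \<otimes> a = a [^] (2 * ord a)"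
      by (metis (no_types, lifting) Suc_diff_le diff_Suc_1 le_add1 le_trans mult_2 nat_pow_Suc plus_1_eq_Suc)
    then show "a [^] (2 * ord a - 1) \<otimes> a = \<one>" by (simp add: aG pow_eq_id)
  qed (use aG in auto)
  moreover have "2 * ord a - 1 = Suc (2 * ord a - 2)" using ord_ge_1[OF fin aG] by simp
  ultimately show "inv a \<in> H" using pow by metis
qed (use assms in auto)

lemma card_subgroup_dvd: "subgroup H G \<Longrightarrow> subgroup K G \<Longrightarrow> H \<subseteq> K \<Longrightarrow> card H dvd card K"
proof -
  assume "subgroup H G" "subgroup K G" "H \<subseteq> K"
  then have "group (G\<lparr>carrier := K\<rparr>)" "subgroup H (G\<lparr>carrier := K\<rparr>)"
    by (simp_all add: subgroup_imp_group subgroup_incl)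
  from group.lagrange[OF this] have "card (rcosets\<^bsub>G\<lparr>carrier := K\<rparr>\<^esub> H) * card H = card K" by (simp add: order_def)
  then show ?thesis by (metis dvd_triv_right)
qed

lemma card_subgroup_pos: "subgroup H G \<Longrightarrow> card H > 0"
  by (metis card_gt_0_iff empty_iff finite_sub subgroup.one_closed subgroup.subset)

lemma normalizes_imp_eq:
  assumes "g \<in> carrier G" "S \<subseteq> carrier G" "\<And>x. x \<in> S \<Longrightarrow> conj_by g x \<in> S"
  shows "conj_by g ` S = S"
  by (rule endo_inj_surj)
     (use assms finite_sub inj_on_subset[OF inj_on_conj_by[OF assms(1)] assms(2)] in auto)

lemma normalizer_memI:
  assumes "g \<in> carrier G" "S \<subseteq> carrier G" "\<And>x. x \<in> S \<Longrightarrow> conj_by g x \<in> S"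
  shows "g \<in> normalizer G S"
  using normalizes_imp_eq[OF assms] assms by (simp add: normalizer_eq)

lemma normalizer_memD:
  assumes "g \<in> normalizer G S" "S \<subseteq> carrier G"
  shows "g \<in> carrier G" "\<And>x. x \<in> S \<Longrightarrow> conj_by g x \<in> S" 
  using assms by (auto simp: normalizer_eq)

lemma normalizer_subgroup: "subgroup S G \<Longrightarrow> subgroup (normalizer G S) G"
  by (simp add: normalizer_imp_subgroup subgroup.subset)

lemma subgroup_conj_by_closed: "subgroup S G \<Longrightarrow> g \<in> S \<Longrightarrow> x \<in> S \<Longrightarrow> conj_by g x \<in> S"
  by (simp add: conj_by_def subgroup.m_closed subgroup.m_inv_closed)

lemma subset_normalizer: "subgroup S G \<Longrightarrow> S \<subseteq> normalizer G S"
  by (meson normalizer_memI subgroup_conj_by_closed subgroup.mem_carrier subgroup.subset subsetI)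

lemma pow_normalizes:
  assumes "c \<in> carrier G" "D \<subseteq> carrier G" "\<And>d. d \<in> D \<Longrightarrow> conj_by c d \<in> D" "d \<in> D"
  shows "conj_by (c [^] (n::nat)) d \<in> D"
proof (induction n)
  case (Suc n)
  have "conj_by (c [^] Suc n) d = conj_by c (conj_by (c [^] n) d)"
    using assms by (simp add: conj_by_conj_by subset_iff) (metis nat_pow_Suc2 nat_pow_Suc)
  with Suc assms show ?case by simp
qed (use assms in auto)

lemma adjoin_subgroup:
  assumes D: "subgroup D G" and c: "c \<in> carrier G" and n: "\<And>d. d \<in> D \<Longrightarrow> conj_by c d \<in> D"
  shows "subgroup (adjoin D c) G" "D \<subseteq> adjoin D c" "c \<in> adjoin D c"
proof -
  have DG: "D \<subseteq> carrier G" using D subgroup.subset by blast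
  show "D \<subseteq> adjoin D c"
    using DG c by (force simp: adjoin_def intro: exI[of _ "0::nat"])
  have "c = \<one> \<otimes> c [^] (1::nat)" using c by simp
  then show "c \<in> adjoin D c" using subgroup.one_closed[OF D] unfolding adjoin_def by blast
  show "subgroup (adjoin D c) G"
  proof (rule finite_subgroupI)
    show "adjoin D c \<subseteq> carrier G" using DG c by (auto simp: adjoin_def)
    show "adjoin D c \<noteq> {}" using \<open>c \<in> adjoin D c\<close> by blast
    fix x y assume "x \<in> adjoin D c" "y \<in> adjoin D c"
    then obtain d e m n where xy: "x = d \<otimes> c [^] (m::nat)" "y = e \<otimes> c [^] (n::nat)" "d \<in> D" "e \<in> D"
      by (auto simp: adjoin_def)
    have "x \<otimes> y = (d \<otimes> conj_by (c [^] m) e) \<otimes> c [^] (m + n)"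
      using xy DG c by (simp add: conj_by_def word_simps subset_iff nat_pow_mult[symmetric])
    moreover have "d \<otimes> conj_by (c [^] m) e \<in> D"
      using xy pow_normalizes[OF c DG n] D subgroup.m_closed by metis
    ultimately show "x \<otimes> y \<in> adjoin D c" unfolding adjoin_def by blast
  qed
qed

lemma adjoin_least:
  assumes "subgroup H G" "D \<subseteq> H" "c \<in> H" shows "adjoin D c \<subseteq> H"
  using assms by (auto simp: adjoin_def subgroup_nat_pow_closed intro!: subgroup.m_closed)

text \<open>
When \<open>u\<close> and \<open>v\<close> commute they cancel from the commutator of \<open>d u\<close> and
\<open>e v\<close>, up to conjugates of \<open>d\<close> and \<open>e\<close>. This is why adjoining a
normalizing element to \<open>D\<close> keeps the derived subgroup inside \<open>D\<close>.
\<close>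
lemma commutator_eq: 
  assumes "d \<in> carrier G" "e \<in> carrier G" "u \<in> carrier G" "v \<in> carrier G" "u \<otimes> v = v \<otimes> u"
  shows "d \<otimes> u \<otimes> (e \<otimes> v) \<otimes> inv (d \<otimes> u) \<otimes> inv (e \<otimes> v)
    = d \<otimes> conj_by u e \<otimes> conj_by v (inv d) \<otimes> inv e"
proof -
  have "d \<otimes> conj_by u e \<otimes> conj_by v (inv d) \<otimes> inv e = d \<otimes> u \<otimes> e \<otimes> (inv u \<otimes> v) \<otimes> inv d \<otimes> inv v \<otimes> inv e"
    using assms by (simp add: conj_by_def word_simps)
  also have "inv u \<otimes> v = v \<otimes> inv u"
    using assms by (metis inv_solve_left inv_solve_right m_closed inv_closed m_assoc)
  finally show ?thesis using assms by (simp add: word_simps)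
qed

lemma solvable_adjoin:
  assumes D: "subgroup D G" and c: "c \<in> carrier G" and n: "\<And>d. d \<in> D \<Longrightarrow> conj_by c d \<in> D"
    and sol: "solvable_seq G D"
  shows "solvable_seq G (adjoin D c)"
proof -
  have DG: "D \<subseteq> carrier G" using D subgroup.subset by blast
  have "derived_set G (adjoin D c) \<subseteq> D"
  proof
    fix s assume "s \<in> derived_set G (adjoin D c)"
    then obtain x y where "x \<in> adjoin D c" "y \<in> adjoin D c" and s: "s = x \<otimes> y \<otimes> inv x \<otimes> inv y" by auto
    then obtain d e m n where xy: "x = d \<otimes> c [^] (m::nat)" "y = e \<otimes> c [^] (n::nat)" and de: "d \<in> D" "e \<in> D"
      by (auto simp: adjoin_def)
    have "s = d \<otimes> conj_by (c [^] m) e \<otimes> conj_by (c [^] n) (inv d) \<otimes> inv e"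
      unfolding s xy using de DG c
      by (intro commutator_eq) (auto simp: nat_pow_mult add.commute)
    also have "\<dots> \<in> D"
      using de pow_normalizes[OF c DG assms(3)] D
      by (metis subgroup.m_closed subgroup.m_inv_closed)
    finally show "s \<in> D" .
  qed
  then have "derived G (adjoin D c) \<subseteq> D"
    unfolding derived_def using D generate_subgroup_incl by blast
  moreover obtain k where "(derived G ^^ k) D = {\<one>}" using solvable_imp_trivial_derived_seq[OF sol] by blast
  ultimately have "(derived G ^^ k) (derived G (adjoin D c)) \<subseteq> {\<one>}"
    using mono_exp_of_derived by blast
  moreover have sub: "subgroup (derived G (adjoin D c)) G"
    using adjoin_subgroup[OF assms(1-3)] by (simp add: derived_is_subgroup subgroup.subset)
  moreover have "\<one> \<in> (derived G ^^ k) (derived G (adjoin D c))"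
    using exp_of_derived_is_subgroup[OF sub] subgroup.one_closed by blast
  ultimately have "solvable_seq G (derived G (adjoin D c))"
    using trivial_derived_seq_imp_solvable[OF sub] by blast
  then show ?thesis using adjoin_subgroup(1)[OF assms(1-3)] augment_solvable_seq by blast
qed

lemma solvable_commute:
  assumes "subgroup H G" "\<And>x y. x \<in> H \<Longrightarrow> y \<in> H \<Longrightarrow> x \<otimes> y = y \<otimes> x"
  shows "solvable_seq G H"
proof -
  have "x \<otimes> y \<otimes> inv x \<otimes> inv y = \<one>" if "x \<in> H" "y \<in> H" for x y
    using assms that by (smt (verit) inv_cancel_left(2) m_assoc subgroup.m_inv_closed subgroup.mem_carrier r_inv)
  then have "derived_set G H \<subseteq> {\<one>}" by auto
  then have "derived G H \<subseteq> {\<one>}" unfolding derived_def using generate_subgroup_incl triv_subgroup by blast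
  moreover have "\<one> \<in> derived G H"
    by (simp add: assms(1) derived_is_subgroup subgroup.one_closed subgroup.subset)
  ultimately have "(derived G ^^ 1) H = {\<one>}" by auto
  then show ?thesis using trivial_derived_seq_imp_solvable[OF assms(1)] by blast
qed

end

section \<open>Groups of prime power order\<close>

text \<open>
The moved points split into orbits, each of size a power of \<open>p\<close> and larger than \<open>1\<close>.
\<close>
lemma (in group_action) prime_dvd_card_moved_points:
  assumes p: "prime (p::nat)" and G: "finite (carrier G)" "order G = p ^ m"
    and T: "T \<subseteq> E" "finite T" "\<And>g x. g \<in> carrier G \<Longrightarrow> x \<in> T \<Longrightarrow> \<phi> g x \<in> T"
  shows "p dvd card {x \<in> T. \<exists>g\<in>carrier G. \<phi> g x \<noteq> x}"
proof -
  let ?M = "{x \<in> T. \<exists>g\<in>carrier G. \<phi> g x \<noteq> x}"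
  interpret grp: group G using group_hom group_hom.axioms(1) by auto
  have sub: "orbit G \<phi> x \<subseteq> ?M" if x: "x \<in> ?M" for x
  proof
    fix y assume y: "y \<in> orbit G \<phi> x"
    then obtain g where g: "g \<in> carrier G" "y = \<phi> g x" by (auto simp: orbit_def)
    then have yT: "y \<in> T" using x T(3) by auto
    have "\<exists>g\<in>carrier G. \<phi> g y \<noteq> y"
    proof (rule ccontr)
      assume "\<not> ?thesis"
      then have fx: "\<And>h. h \<in> carrier G \<Longrightarrow> \<phi> h y = y" by auto
      have "x \<in> orbit G \<phi> y" using orbit_sym[OF _ _ y] x yT T(1) by auto
      then have "x = y" using fx by (auto simp: orbit_def)
      then show False using fx x by auto
    qed
    with yT show "y \<in> ?M" by blast
  qed
  have M: "?M = \<Union> (orbit G \<phi> ` ?M)"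
    using sub orbit_refl T(1) by blast
  have disj: "pairwise disjnt (orbit G \<phi> ` ?M)"
  proof (clarsimp simp: pairwise_def disjnt_def)
    fix x y assume x: "x \<in> T" and y: "y \<in> T" and ne: "orbit G \<phi> x \<noteq> orbit G \<phi> y"
    have "orbit G \<phi> x \<in> orbits G E \<phi>" "orbit G \<phi> y \<in> orbits G E \<phi>"
      using x y T(1) by (auto simp: orbits_def)
    then show "orbit G \<phi> x \<inter> orbit G \<phi> y = {}"
      using ne disjoint_union by blast
  qed
  have "p dvd card c" if "c \<in> orbit G \<phi> ` ?M" for c
  proof -
    obtain x where x: "x \<in> ?M" "c = orbit G \<phi> x" using \<open>c \<in> _\<close> by blast
    have "card c dvd p ^ m"
      using orbit_stabilizer_theorem[of x] x T(1) G(2) by (metis (lifting) dvd_triv_left mem_Collect_eq subsetD)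
    then obtain i where i: "card c = p ^ i" using p divides_primepow_nat by blast
    have "card c \<noteq> 1"
    proof
      assume "card c = 1"
      then obtain y where "c = {y}" using card_1_singletonE by blast
      then have "\<And>g. g \<in> carrier G \<Longrightarrow> \<phi> g x = x"
        using orbit_refl[of x] x T(1) by (auto simp: orbit_def)
      then show False using x by blast
    qed
    with i show ?thesis by (cases i) auto
  qed
  moreover have "card ?M = (\<Sum>c\<in>orbit G \<phi> ` ?M. card c)"
  proof -
    have "finite c" if "c \<in> orbit G \<phi> ` ?M" for c
      using that sub T(2) by (metis (no_types, lifting) finite_subset imageE mem_Collect_eq subsetI)
    then show ?thesis using M card_Union_disjoint[OF disj] by simp
  qed
  ultimately show ?thesis by (simp add: dvd_sum)
qed

context finite_group
begin

lemma cauchy: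
  assumes H: "subgroup H G" and q: "prime q" "q dvd card H"
  obtains x where "x \<in> H" "x \<noteq> \<one>" "x [^] q = \<one>"
proof -
  obtain m where "card H = q ^ 1 * m" using q by auto
  moreover have "group (G\<lparr>carrier := H\<rparr>)" "finite H"
    using H by (simp_all add: subgroup_imp_group finite_sub subgroup.subset)
  ultimately obtain K where K: "subgroup K (G\<lparr>carrier := H\<rparr>)" "card K = q"
    using sylow_thm[OF q(1), of "G\<lparr>carrier := H\<rparr>" 1 m] by (auto simp: order_def)
  then have KH: "K \<subseteq> H" and KG: "subgroup K G" 
    using subgroup.subset incl_subgroup[OF H] by force+
  have "card K > 1" using K q prime_gt_1_nat by simp
  then obtain x where x: "x \<in> K" "x \<noteq> \<one>"
    by (metis card_1_singleton_iff is_singletonI' is_singleton_altdef less_irrefl KG subgroup.one_closed empty_iff)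
  have "x [^]\<^bsub>G\<lparr>carrier := K\<rparr>\<^esub> order (G\<lparr>carrier := K\<rparr>) = \<one>"
    using group.pow_order_eq_1[OF subgroup_imp_group[OF KG]] x by simp
  then have "x [^] q = \<one>"
    using K by (simp add: order_def nat_pow_consistent[symmetric])
  with x KH that show ?thesis by blast
qed

lemma prime_power_exponent:
  assumes H: "subgroup H G" and p: "prime p" and e: "\<And>x. x \<in> H \<Longrightarrow> x [^] (p ^ k) = \<one>"
  obtains n where "card H = p ^ n"
proof -
  have "q = p" if q: "prime q" "q dvd card H" for q
  proof (rule ccontr)
    assume "q \<noteq> p"
    obtain x where x: "x \<in> H" "x \<noteq> \<one>" "x [^] q = \<one>" using cauchy[OF H q] .
    have xG: "x \<in> carrier G" using subgroup.mem_carrier[OF H x(1)] .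
    have "ord x dvd q" "ord x dvd p ^ k" using x xG e pow_eq_id by auto
    moreover have "coprime q (p ^ k)" using q(1) p \<open>q \<noteq> p\<close> by (simp add: primes_coprime)
    ultimately have "ord x = 1" by (metis coprime_common_divisor_nat)
    then show False using x xG ord_eq_1 by blast
  qed
  moreover have "card H \<noteq> 0" using card_subgroup_pos[OF H] by simp
  moreover obtain m where m: "card H = p ^ multiplicity p (card H) * m" "\<not> p dvd m"
    using multiplicity_decompose'[of "card H" p] calculation p by (metis not_prime_unit)
  ultimately have "m = 1" using prime_factor_nat[of m] by (metis dvd_mult)
  then show ?thesis using m that by simp
qed

text \<open>
If \<open>D\<close> were its own normalizer in \<open>P\<close>, the number of its \<open>P\<close>-conjugates
would be \<open>|P : D|\<close>, a multiple of \<open>p\<close>. But \<open>D\<close> acts on them fixing only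
\<open>D\<close> itself, since a fixed conjugate is normalized by \<open>D\<close>; so that number is
\<open>1\<close> modulo \<open>p\<close>.
\<close>
lemma normalizers_grow:
  assumes D: "subgroup D G" and P: "subgroup P G" "card P = p ^ n" and p: "prime p" and DP: "D \<subset> P"
  obtains x where "x \<in> P - D" "x \<in> normalizer G D"
proof (rule ccontr)
  assume "\<not> thesis"
  with that have no: "\<And>x. x \<in> P \<Longrightarrow> x \<in> normalizer G D \<Longrightarrow> x \<in> D" by blast
  define \<phi> where "\<phi> = (\<lambda>g. \<lambda>H\<in>{H. H \<subseteq> carrier G}. g <# H #> inv g)"
  have act: "group_action G {H. H \<subseteq> carrier G} \<phi>"
    unfolding \<phi>_def by (rule action_by_conjugation_on_power_set)
  have \<phi>: "\<phi> g S = conj_by g ` S" if "S \<subseteq> carrier G" for g S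
    using that by (simp add: \<phi>_def conj_by_coset)
  have PG: "P \<subseteq> carrier G" and DG: "D \<subseteq> carrier G" using D P subgroup.subset by auto
  interpret aP: group_action "G\<lparr>carrier := P\<rparr>" "{H. H \<subseteq> carrier G}" \<phi>
    using group_action.induced_action[OF act P(1)] .
  interpret aD: group_action "G\<lparr>carrier := D\<rparr>" "{H. H \<subseteq> carrier G}" \<phi>
    using group_action.induced_action[OF act D] .
  define T where "T = {conj_by g ` D | g. g \<in> P}"
  have TG: "S \<subseteq> carrier G" if "S \<in> T" for S
    using that PG DG by (auto simp: T_def subset_iff)
  have "orbit (G\<lparr>carrier := P\<rparr>) \<phi> D = T"
    using DG by (auto simp: orbit_def T_def \<phi>)
  moreover have "stabilizer (G\<lparr>carrier := P\<rparr>) \<phi> D = D"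
  proof
    show "stabilizer (G\<lparr>carrier := P\<rparr>) \<phi> D \<subseteq> D"
      using no DG PG by (auto simp: stabilizer_def \<phi> normalizer_eq)
    show "D \<subseteq> stabilizer (G\<lparr>carrier := P\<rparr>) \<phi> D"
      using DP DG subset_normalizer[OF D] by (auto simp: stabilizer_def \<phi> normalizer_eq)
  qed
  ultimately have cT: "card T * card D = p ^ n"
    using aP.orbit_stabilizer_theorem[of D] DG P by (simp add: order_def)
  have finT: "finite T" unfolding T_def using finite_sub[OF PG] by auto
  have "card D dvd p ^ n" using card_subgroup_dvd[OF D P(1)] DP P(2) by auto
  then obtain m where m: "card D = p ^ m" using p divides_primepow_nat by blast
  have "card D < card P" using DP finite_sub[OF PG] psubset_card_mono by blast
  then have "card T \<noteq> 1" using cT P(2) by auto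
  moreover have "card T dvd p ^ n" using cT by (metis dvd_triv_left)
  ultimately have pT: "p dvd card T" using p divides_primepow_nat by (metis dvd_power gr0I power_0)
  let ?M = "{S \<in> T. \<exists>g\<in>carrier (G\<lparr>carrier := D\<rparr>). \<phi> g S \<noteq> S}"
  have pM: "p dvd card ?M"
  proof (rule aD.prime_dvd_card_moved_points[OF p])
    fix g S assume "g \<in> carrier (G\<lparr>carrier := D\<rparr>)" and S: "S \<in> T"
    then have g: "g \<in> P" using DP by auto
    obtain h where "h \<in> P" "S = conj_by h ` D" using S by (auto simp: T_def)
    then have "\<phi> g S = conj_by (g \<otimes> h) ` D" "g \<otimes> h \<in> P"
      using g TG[OF S] PG DG P(1) by (auto simp: \<phi> conj_by_image_conj_by subset_iff subgroup.m_closed)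
    then show "\<phi> g S \<in> T" by (auto simp: T_def)
  qed (use m TG finT DG finite_sub in \<open>auto simp: order_def\<close>)
  have "T - ?M = {D}"
  proof
    have "conj_by \<one> ` D = D" by (rule conj_by_image_one[OF DG])
    then have DT: "D \<in> T" unfolding T_def using P(1) subgroup.one_closed by blast
    moreover have "\<phi> g D = D" if "g \<in> D" for g
      using that subset_normalizer[OF D] DG by (auto simp: \<phi> normalizer_eq)
    ultimately show "{D} \<subseteq> T - ?M" by auto
    show "T - ?M \<subseteq> {D}"
    proof
      fix S assume S: "S \<in> T - ?M"
      then have fx: "conj_by d ` S = S" if "d \<in> D" for d using that TG by (auto simp: \<phi>)
      obtain g where g: "g \<in> P" "S = conj_by g ` D" using S by (auto simp: T_def)
      have gG: "g \<in> carrier G" using g PG by auto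
      have "conj_by (inv g) d \<in> D" if d: "d \<in> D" for d
      proof -
        have dG: "d \<in> carrier G" using d DG by auto
        have "conj_by (conj_by (inv g) d) ` D = conj_by (inv g) ` conj_by d ` conj_by g ` D"
          using gG dG DG by (subst (1 2) conj_by_image_conj_by) (auto simp: conj_by_def[of "inv g" d] m_assoc)
        also have "\<dots> = D" using fx[OF d] g(2) conj_by_image_inv[OF gG DG refl] by simp
        finally have "conj_by (inv g) d \<in> normalizer G D"
          using gG dG DG by (simp add: normalizer_eq)
        moreover have "conj_by (inv g) d \<in> P"
          using subgroup_conj_by_closed[OF P(1)] subgroup.m_inv_closed[OF P(1) g(1)] d DP by blast
        ultimately show ?thesis using no by blast
      qed
      then have "conj_by (inv g) ` D = D" using normalizes_imp_eq[of "inv g" D] gG DG by blast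
      then have "conj_by g ` D = D" using conj_by_image_inv[of "inv g" D D] gG DG by simp
      then show "S \<in> {D}" using g by simp
    qed
  qed
  then have "card T = card ?M + 1"
    using finT by (metis (no_types, lifting) card_Diff_subset card_mono card_1_singleton_iff le_add_diff_inverse finite_subset mem_Collect_eq subsetI One_nat_def)
  with pT pM have "p dvd 1" using dvd_add_right_iff[OF pM, of 1] by (simp only:)
  with p show False by simp
qed

text \<open>
A maximal proper subgroup of a \<open>p\<close>-group is normal because normalizers grow, and one further
element then generates the whole group.
\<close>
lemma solvable_prime_power:
  assumes p: "prime p"
  shows "subgroup H G \<Longrightarrow> card H = p ^ n \<Longrightarrow> solvable_seq G H"
proof (induction "card H" arbitrary: H n rule: less_induct)
  case less
  have HG: "H \<subseteq> carrier G" using less.prems(1) by (rule subgroup.subset)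
  show ?case
  proof (cases "H = {\<one>}")
    case True
    then show ?thesis using solvable_seq.unity by metis
  next
    case False
    let ?\<D> = "{D. subgroup D G \<and> D \<subset> H}"
    have "?\<D> \<subseteq> Pow (carrier G)" using HG by auto
    then have fin\<D>: "finite ?\<D>" using fin finite_subset by blast
    have "{\<one>} \<in> ?\<D>" using False less.prems triv_subgroup subgroup.one_closed by auto
    then obtain D where D: "D \<in> ?\<D>" and max: "\<And>E. E \<in> ?\<D> \<Longrightarrow> D \<subseteq> E \<Longrightarrow> E = D"
      using finite_has_maximal[OF fin\<D>] by (metis (lifting) empty_iff)
    obtain x where x: "x \<in> H - D" "x \<in> normalizer G D"
      using normalizers_grow[of D H p n] D less.prems p by blast
    have DG: "D \<subseteq> carrier G" and xG: "x \<in> carrier G" using D HG x by auto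
    have n: "\<And>d. d \<in> D \<Longrightarrow> conj_by x d \<in> D" using normalizer_memD[OF x(2) DG] by blast
    have "subgroup D G" using D by simp
    note adj = adjoin_subgroup[OF this xG n]
    have "adjoin D x \<subseteq> H" using adjoin_least[of H D x] less.prems D x by auto
    moreover have "adjoin D x \<noteq> D" using adj x by blast
    ultimately have H: "adjoin D x = H" using adj(1,2) max[of "adjoin D x"] by (metis (lifting) mem_Collect_eq psubsetI)
    have "card D < card H" using D finite_sub[OF HG] psubset_card_mono by blast
    moreover have "card D dvd p ^ n" using card_subgroup_dvd[of D H] D less.prems by auto
    ultimately have "solvable_seq G D" using less.hyps D p divides_primepow_nat by (metis (lifting) mem_Collect_eq)
    then show ?thesis using solvable_adjoin[of D x] D xG n H by auto
  qed
qed

lemma pow_mod_ord: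
  assumes "a \<in> carrier G" shows "a [^] (n mod ord a) = a [^] (n :: nat)"
proof -
  have "a [^] n = a [^] (ord a * (n div ord a) + n mod ord a)" by simp
  also have "\<dots> = (a [^] ord a) [^] (n div ord a) \<otimes> a [^] (n mod ord a)"
    by (simp only: nat_pow_mult[OF assms] nat_pow_pow[OF assms])
  also have "\<dots> = a [^] (n mod ord a)" using assms by simp
  finally show ?thesis by simp
qed

text \<open>
A cyclic group has at most one subgroup of order \<open>p\<close>. All later uniqueness statements about the
central element \<open>z\<close> inside cyclic subgroups come from this.
\<close>
lemma cyclic_prime_roots:
  assumes a: "a \<in> carrier G" and p: "prime p"
    and z: "z \<in> cyc a" "z \<noteq> \<one>" "z [^] p = \<one>" and x: "x \<in> cyc a" "x [^] p = \<one>"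
  obtains k where "k < p" "x = z [^] (k::nat)"
proof -
  obtain i j where i: "z = a [^] (i::nat)" and j: "x = a [^] (j::nat)"
    using z x cyc_nat[OF a] by auto
  let ?r = "ord a"
  have ri: "\<not> ?r dvd i" "?r dvd i * p" "?r dvd j * p"
    using z x a by (auto simp: i j pow_eq_id nat_pow_pow)
  then have "p dvd ?r" by (metis coprime_dvd_mult_left_iff p prime_imp_coprime coprime_commute)
  then obtain m where m: "?r = p * m" by auto
  have p0: "p > 0" using p prime_gt_0_nat by auto
  have "m dvd i" "m dvd j" using ri m p0 by (auto simp: mult.commute)
  then obtain i' j' where i': "i = m * i'" and j': "j = m * j'" by (auto elim!: dvdE)
  have "\<not> p dvd i'" using ri(1) m i' by (metis mult.commute mult_dvd_mono dvd_refl)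
  then have "coprime i' p" using prime_imp_coprime[OF p] by (metis coprime_commute)
  then obtain u where u: "[i' * u = 1] (mod p)" using cong_solve_coprime_nat[of i' p] by auto
  define k where "k = (u * j') mod p"
  have "[i' * k = i' * (u * j')] (mod p)" unfolding k_def by (simp add: cong_scalar_left)
  also have "i' * (u * j') = (i' * u) * j'" by simp
  also have "[(i' * u) * j' = 1 * j'] (mod p)" using u cong_scalar_right by blast
  finally have "[i' * k = j'] (mod p)" by simp
  then have "[m * (i' * k) = m * j'] (mod (m * p))" by (rule cong_cmult_leftI)
  then have "[i * k = j] (mod ?r)" using m i' j' by (simp add: mult.commute mult.left_commute)
  then have "a [^] (i * k) = a [^] j"
    using pow_mod_ord[OF a] by (metis cong_def)
  then have "x = z [^] k" using a by (simp add: i j nat_pow_pow)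
  moreover have "k < p" using p0 by (simp add: k_def)
  ultimately show ?thesis using that by blast
qed

end

text \<open>
The collection formula when \<open>y\<close> and \<open>w\<close> commute up to a central factor
\<open>s\<close>: each time a \<open>y\<close> passes a \<open>w\<close> one factor \<open>s\<close> appears.
\<close>
lemma (in group) class_two_power:
  assumes c: "w \<in> carrier G" "y \<in> carrier G" "s \<in> carrier G"
    and eq: "y \<otimes> w = s \<otimes> (w \<otimes> y)" and s: "\<And>g. g \<in> carrier G \<Longrightarrow> s \<otimes> g = g \<otimes> s"
  shows "(w \<otimes> y) [^] (n::nat) = s [^] (n * (n - 1) div 2) \<otimes> (w [^] n \<otimes> y [^] n)"
proof -
  have sn: "s [^] (n::nat) \<otimes> g = g \<otimes> s [^] n" if "g \<in> carrier G" for g n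
    using group_commutes_pow[OF s[OF that] c(3) that] .
  have yw: "y [^] n \<otimes> w = s [^] n \<otimes> (w \<otimes> y [^] n)" for n :: nat
  proof (induction n)
    case (Suc n)
    have "y [^] Suc n \<otimes> w = y [^] n \<otimes> (y \<otimes> w)" using c by (simp add: m_assoc)
    also have "\<dots> = (y [^] n \<otimes> s) \<otimes> (w \<otimes> y)" unfolding eq using c by (simp add: m_assoc)
    also have "\<dots> = s \<otimes> (y [^] n \<otimes> w) \<otimes> y" using c s[of "y [^] n"] by (simp add: m_assoc[symmetric])
    also have "\<dots> = s \<otimes> s [^] n \<otimes> (w \<otimes> (y [^] n \<otimes> y))" unfolding Suc.IH using c by (simp add: m_assoc)
    also have "\<dots> = s [^] Suc n \<otimes> (w \<otimes> y [^] Suc n)" using c s by simp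
    finally show ?case .
  qed (use c in simp)
  show ?thesis
  proof (induction n)
    case (Suc n)
    let ?k = "n * (n - 1) div 2"
    have "(w \<otimes> y) [^] Suc n = s [^] ?k \<otimes> (w [^] n \<otimes> (y [^] n \<otimes> w) \<otimes> y)"
      using Suc.IH c by (simp add: m_assoc)
    also have "\<dots> = s [^] ?k \<otimes> ((w [^] n \<otimes> s [^] n) \<otimes> (w \<otimes> (y [^] n \<otimes> y)))"
      unfolding yw using c by (simp add: m_assoc)
    also have "w [^] n \<otimes> s [^] n = s [^] n \<otimes> w [^] n" using c sn by simp
    also have "s [^] ?k \<otimes> (s [^] n \<otimes> w [^] n \<otimes> (w \<otimes> (y [^] n \<otimes> y))) = s [^] ?k \<otimes> s [^] n \<otimes> (w [^] Suc n \<otimes> y [^] Suc n)"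
      using c by (simp add: m_assoc)
    also have "s [^] ?k \<otimes> s [^] n = s [^] (Suc n * (Suc n - 1) div 2)"
    proof -
      have "Suc n * (Suc n - 1) = n * (n - 1) + 2 * n" by (cases n) auto
      then have "Suc n * (Suc n - 1) div 2 = ?k + n" by simp
      then show ?thesis using c by (simp add: nat_pow_mult)
    qed
    finally show ?case .
  qed (use c in simp)
qed

text \<open>
For odd \<open>p\<close> the exponent \<open>p (p - 1)/2\<close> of \<open>s\<close> is a multiple of
\<open>p\<close>. For \<open>p = 2\<close> it is not, and this separates the two halves of the proof.
\<close>
corollary (in group) class_two_odd_power:
  assumes "w \<in> carrier G" "y \<in> carrier G" "s \<in> carrier G"
    and "y \<otimes> w = s \<otimes> (w \<otimes> y)" and "\<And>g. g \<in> carrier G \<Longrightarrow> s \<otimes> g = g \<otimes> s"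
    and "odd p" "s [^] (p::nat) = \<one>"
  shows "(w \<otimes> y) [^] p = w [^] p \<otimes> y [^] p"
proof -
  have "p * (p - 1) div 2 = p * ((p - 1) div 2)" using \<open>odd p\<close> by (simp add: div_mult_swap)
  then have "s [^] (p * (p - 1) div 2) = \<one>" using assms by (simp add: nat_pow_pow[symmetric])
  then show ?thesis using class_two_power[OF assms(1-5), of p] assms(1,2) by simp
qed

section \<open>Counting by conjugacy classes of blocks\<close>

text \<open>
The members of \<open>\<B>\<close> partition \<open>G\<close> modulo \<open>Z\<close>: outside
\<open>Z\<close> every element lies in exactly one of them.
\<close>
locale block_system = finite_group +
  fixes Z :: "'a set" and \<B> :: "'a set set"
  assumes Z_subgroup: "subgroup Z G"
    and block_subgroup: "B \<in> \<B> \<Longrightarrow> subgroup B G"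
    and Z_block: "B \<in> \<B> \<Longrightarrow> Z \<subset> B"
    and block_conj: "B \<in> \<B> \<Longrightarrow> g \<in> carrier G \<Longrightarrow> conj_by g ` B \<in> \<B>"
    and block_meet: "B \<in> \<B> \<Longrightarrow> C \<in> \<B> \<Longrightarrow> B \<noteq> C \<Longrightarrow> B \<inter> C \<subseteq> Z"
    and block_cover: "g \<in> carrier G - Z \<Longrightarrow> \<exists>B\<in>\<B>. g \<in> B"
begin

definition class_union :: "'a set \<Rightarrow> 'a set" where
  "class_union B = (\<Union>g\<in>carrier G. conj_by g ` B) - Z"

definition weight :: "'a set \<Rightarrow> real" where
  "weight B = card (class_union B) / order G"

text \<open>
Families of pairwise non-conjugate blocks, expressed through the sets that their classes fill.
\<close>
definition class_disjoint :: "'a set set \<Rightarrow> bool" where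
  "class_disjoint \<S> \<longleftrightarrow> \<S> \<subseteq> \<B> \<and> pairwise (\<lambda>B C. class_union B \<inter> class_union C = {}) \<S>"

lemma block_carrier: "B \<in> \<B> \<Longrightarrow> B \<subseteq> carrier G"
  using block_subgroup subgroup.subset by blast

lemma order_pos: "order G > 0"
  using fin order_gt_0_iff_finite by blast

lemma cls_carrier: "B \<in> \<B> \<Longrightarrow> class_union B \<subseteq> carrier G - Z"
  using block_carrier by (auto simp: class_union_def subset_iff)

lemma finite_cls: "B \<in> \<B> \<Longrightarrow> finite (class_union B)"
  using cls_carrier finite_sub by blast

lemma block_subset_cls: "B \<in> \<B> \<Longrightarrow> B - Z \<subseteq> class_union B"
proof
  fix x assume "B \<in> \<B>" "x \<in> B - Z"
  then have "conj_by \<one> x = x" using block_carrier[of B] by (auto simp: subset_iff)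
  then have "x \<in> conj_by \<one> ` B" using \<open>x \<in> B - Z\<close> by (metis DiffD1 imageI)
  then show "x \<in> class_union B" using \<open>x \<in> B - Z\<close> unfolding class_union_def by blast
qed

text \<open>
Distinct conjugates of a block meet only in \<open>Z\<close>, so their contributions outside \<open>Z\<close>
add up; the number of conjugates is the index of the normalizer.
\<close>
lemma card_cls:
  assumes B: "B \<in> \<B>"
  shows "card (class_union B) * card (normalizer G B) = (card B - card Z) * order G"
proof -
  have BG: "B \<subseteq> carrier G" using block_carrier[OF B] .
  define \<phi> where "\<phi> = (\<lambda>g. \<lambda>H\<in>{H. H \<subseteq> carrier G}. g <# H #> inv g)"
  interpret act: group_action G "{H. H \<subseteq> carrier G}" \<phi>
    unfolding \<phi>_def by (rule action_by_conjugation_on_power_set)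
  define T where "T = {conj_by g ` B | g. g \<in> carrier G}"
  have "orbit G \<phi> B = T"
    using BG by (auto simp: orbit_def T_def \<phi>_def conj_by_coset)
  then have cT: "card T * card (normalizer G B) = order G"
    using act.orbit_stabilizer_theorem[of B] BG by (simp add: normalizer_def \<phi>_def)
  have TB: "S \<in> \<B>" if "S \<in> T" for S using that block_conj[OF B] by (auto simp: T_def)
  have cS: "card (S - Z) = card B - card Z" if "S \<in> T" for S
  proof -
    have "card S = card B" using that BG card_conj_by_image by (auto simp: T_def)
    moreover have "Z \<subseteq> S" using Z_block TB[OF that] by blast
    ultimately show ?thesis
      using card_Diff_subset[of Z S] finite_sub Z_subgroup subgroup.subset by metis
  qed
  have "class_union B = \<Union> ((\<lambda>S. S - Z) ` T)" by (auto simp: class_union_def T_def)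
  moreover have "card \<dots> = (\<Sum>S\<in>T. card (S - Z))"
  proof (rule card_UN_disjoint)
    show "finite T" unfolding T_def using fin by simp
    show "\<forall>S\<in>T. finite (S - Z)" by (meson TB block_carrier finite_sub finite_Diff)
    show "\<forall>S\<in>T. \<forall>S'\<in>T. S \<noteq> S' \<longrightarrow> (S - Z) \<inter> (S' - Z) = {}" using TB block_meet by blast
  qed
  ultimately have "card (class_union B) = card T * (card B - card Z)" using cS by simp
  then show ?thesis using cT by (metis mult.assoc mult.commute)
qed

lemma weight_eq:
  assumes B: "B \<in> \<B>" and e: "card (normalizer G B) = e * card B"
  shows "weight B = (1 - card Z / card B) / e"
proof -
  have pos: "card B > 0" "card (normalizer G B) > 0"
    using B block_subgroup card_subgroup_pos normalizer_subgroup by auto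
  then have e0: "e > 0" using e by (metis gr0I mult_is_0 less_irrefl)
  have "card Z \<le> card B" using Z_block[OF B] block_carrier[OF B] finite_sub by (simp add: card_mono psubset_imp_subset)
  then have "real (card (class_union B)) * (e * card B) = (real (card B) - card Z) * order G"
    using card_cls[OF B] unfolding e by (metis of_nat_diff of_nat_mult)
  then show ?thesis using pos e0 order_pos by (simp add: weight_def field_simps)
qed

lemma block_index:
  assumes B: "B \<in> \<B>"
  obtains n where "card B = n * card Z" "n \<ge> 2"
proof -
  have "card Z dvd card B" using card_subgroup_dvd[OF Z_subgroup block_subgroup[OF B]] Z_block[OF B] by blast
  then obtain n where n: "card B = n * card Z" by (metis dvd_div_mult_self)
  have "card Z < card B" using Z_block[OF B] block_carrier[OF B] finite_sub psubset_card_mono by blast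
  then have "n \<noteq> 0" "n \<noteq> 1" using n by auto
  then have "n \<ge> 2" by simp
  with n that show ?thesis by blast
qed

lemma Z_card_pos: "card Z > 0"
  using Z_subgroup card_subgroup_pos by auto

lemma weight_index:
  assumes "B \<in> \<B>" "card (normalizer G B) = e * card B" "card B = n * card Z"
  shows "weight B = (1 - 1 / n) / e"
  using weight_eq[OF assms(1,2)] assms(3) Z_card_pos by simp

lemma weight_self_normalizing:
  assumes B: "B \<in> \<B>" and N: "normalizer G B = B"
  shows "weight B \<ge> 1/2"
proof -
  obtain n where n: "card B = n * card Z" "n \<ge> 2" using block_index[OF B] .
  then have "weight B = 1 - 1 / n" using weight_index[OF B, of 1 n] N by simp
  moreover have "1 / real n \<le> 1 / 2" using n by (simp add: field_simps)
  ultimately show ?thesis by linarith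
qed

lemma class_disjoint_finite: "class_disjoint \<S> \<Longrightarrow> finite \<S>"
proof -
  assume "class_disjoint \<S>"
  then have "\<S> \<subseteq> Pow (carrier G)" using block_carrier by (auto simp: class_disjoint_def)
  then show ?thesis using fin finite_subset by blast
qed

lemma class_disjoint_card: "class_disjoint \<S> \<Longrightarrow> card (\<Union>B\<in>\<S>. class_union B) = (\<Sum>B\<in>\<S>. card (class_union B))"
  by (rule card_UN_disjoint) (use class_disjoint_finite finite_cls in \<open>auto simp: class_disjoint_def pairwise_def\<close>)

lemma class_disjoint_weight: "class_disjoint \<S> \<Longrightarrow> (\<Sum>B\<in>\<S>. weight B) = card (\<Union>B\<in>\<S>. class_union B) / order G"
  by (simp add: class_disjoint_card weight_def sum_divide_distrib)

lemma card_outside: "real (card (carrier G - Z)) / order G = 1 - card Z / order G"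
proof -
  have "Z \<subseteq> carrier G" using Z_subgroup subgroup.subset by blast
  then have "real (card (carrier G - Z)) = real (order G) - card Z"
    using fin by (simp add: card_Diff_subset finite_sub order_def card_mono of_nat_diff)
  then show ?thesis using order_pos by (simp add: field_simps)
qed

lemma class_disjoint_sum_le: "class_disjoint \<S> \<Longrightarrow> (\<Sum>B\<in>\<S>. weight B) \<le> 1 - card Z / order G"
proof -
  assume S: "class_disjoint \<S>"
  then have "(\<Union>B\<in>\<S>. class_union B) \<subseteq> carrier G - Z" using cls_carrier by (auto simp: class_disjoint_def)
  then have "card (\<Union>B\<in>\<S>. class_union B) \<le> card (carrier G - Z)" by (simp add: fin card_mono)
  then show ?thesis
    unfolding class_disjoint_weight[OF S] card_outside[symmetric] by (simp add: divide_right_mono)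
qed

text \<open>
As long as the weights do not exhaust \<open>G\<close> outside \<open>Z\<close>, an uncovered element lies in
a block of a new class. The arguments below list the classes one by one with this lemma until their weights
would exceed \<open>1\<close>.
\<close>
lemma class_disjoint_extend:
  assumes S: "class_disjoint \<S>" and ne: "(\<Sum>B\<in>\<S>. weight B) \<noteq> 1 - card Z / order G"
  obtains C where "C \<in> \<B>" "C \<notin> \<S>" "class_disjoint (insert C \<S>)"
proof -
  have "(\<Union>B\<in>\<S>. class_union B) \<noteq> carrier G - Z"
    using ne unfolding class_disjoint_weight[OF S] card_outside[symmetric] by auto
  moreover have "(\<Union>B\<in>\<S>. class_union B) \<subseteq> carrier G - Z" using S cls_carrier by (auto simp: class_disjoint_def)
  ultimately obtain g where g: "g \<in> carrier G - Z" "\<And>B. B \<in> \<S> \<Longrightarrow> g \<notin> class_union B" by blast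
  obtain C where C: "C \<in> \<B>" "g \<in> C" using block_cover[OF g(1)] by blast
  have "g \<in> class_union C" using block_subset_cls[OF C(1)] C g by blast
  have disj: "class_union B \<inter> class_union C = {}" if B: "B \<in> \<S>" for B
  proof (rule ccontr)
    assume "\<not> ?thesis"
    then obtain x where x: "x \<in> class_union B" "x \<in> class_union C" by blast
    have BB: "B \<in> \<B>" using B S by (auto simp: class_disjoint_def)
    obtain a b where ab: "a \<in> carrier G" "b \<in> carrier G" "x \<in> conj_by a ` B" "x \<in> conj_by b ` C" "x \<notin> Z"
      using x by (auto simp: class_union_def)
    then have "conj_by b ` C = conj_by a ` B" using block_meet block_conj BB C(1) by blast
    then have "C = conj_by (inv b) ` conj_by a ` B" using conj_by_image_inv[OF ab(2) block_carrier[OF C(1)]] by blast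
    also have "\<dots> = conj_by (inv b \<otimes> a) ` B" using ab block_carrier[OF BB] by (simp add: conj_by_image_conj_by)
    finally have "g \<in> conj_by (inv b \<otimes> a) ` B" using C(2) by simp
    moreover have "inv b \<otimes> a \<in> carrier G" using ab by simp
    ultimately have "g \<in> class_union B" using g(1) unfolding class_union_def by blast
    then show False using g(2) B by blast
  qed
  have "C \<notin> \<S>" using \<open>g \<in> class_union C\<close> g(2) by blast
  moreover have "class_disjoint (insert C \<S>)"
    using S C disj by (auto simp: class_disjoint_def pairwise_insert Int_commute)
  ultimately show ?thesis using C that by blast
qed

lemma class_disjoint_single: "B \<in> \<B> \<Longrightarrow> class_disjoint {B}"
  by (auto simp: class_disjoint_def)

lemma class_disjoint_sum_less: "class_disjoint \<S> \<Longrightarrow> (\<Sum>B\<in>\<S>. weight B) < 1"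
  using class_disjoint_sum_le[of \<S>] Z_card_pos order_pos by (smt (verit) divide_pos_pos of_nat_0_less_iff)

text \<open>
A self-normalizing block has weight at least \<open>1/2\<close>, so two classes of them are too many, and a
single class fills \<open>G\<close> only if the block is \<open>G\<close>.
\<close>
lemma not_all_self_normalizing:
  assumes B: "B \<in> \<B>" "B \<noteq> carrier G" and N: "\<And>C. C \<in> \<B> \<Longrightarrow> normalizer G C = C"
  shows False
proof -
  obtain n where n: "card B = n * card Z" "n \<ge> 2" using block_index[OF B(1)] .
  have "weight B = 1 - 1 / n" using weight_index[OF B(1), of 1 n] N[OF B(1)] n by simp
  also have "\<dots> \<noteq> 1 - card Z / order G"
  proof
    assume "1 - 1 / n = 1 - card Z / order G"
    then have "real (card B) = order G" using n Z_card_pos order_pos by (simp add: field_simps)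
    then have "card B = card (carrier G)" by (simp add: order_def)
    then show False using B block_carrier fin card_subset_eq by blast
  qed
  finally obtain C where C: "C \<in> \<B>" "C \<notin> {B}" "class_disjoint (insert C {B})"
    using class_disjoint_extend[OF class_disjoint_single[OF B(1)]] by auto
  then have "weight C + weight B < 1" using class_disjoint_sum_less[OF C(3)] by simp
  moreover have "weight C \<ge> 1/2" "weight B \<ge> 1/2"
    using weight_self_normalizing B(1) C(1) N by blast+
  ultimately show False by linarith
qed

end

section \<open>Cyclic cores and their centralizers\<close>

context finite_group
begin

definition center :: "'a set" where
  "center = {x \<in> carrier G. \<forall>g\<in>carrier G. g \<otimes> x = x \<otimes> g}"

lemma center_carrier: "center \<subseteq> carrier G"
  by (auto simp: center_def)

lemma center_commute: "x \<in> center \<Longrightarrow> g \<in> carrier G \<Longrightarrow> g \<otimes> x = x \<otimes> g"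
  by (auto simp: center_def)

lemma center_subgroup: "subgroup center G"
proof (rule finite_subgroupI)
  fix x y assume "x \<in> center" "y \<in> center"
  then have *: "x \<in> carrier G" "y \<in> carrier G" 
    "\<And>g. g \<in> carrier G \<Longrightarrow> g \<otimes> x = x \<otimes> g" "\<And>g. g \<in> carrier G \<Longrightarrow> g \<otimes> y = y \<otimes> g"
    by (auto simp: center_def)
  have "g \<otimes> (x \<otimes> y) = x \<otimes> y \<otimes> g" if g: "g \<in> carrier G" for g
  proof -
    have "g \<otimes> (x \<otimes> y) = x \<otimes> (g \<otimes> y)" using *(3)[OF g] *(1,2) g by (simp add: m_assoc[symmetric])
    then show ?thesis using *(4)[OF g] *(1,2) g by (simp add: m_assoc)
  qed
  then show "x \<otimes> y \<in> center" unfolding center_def using *(1,2) by blast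
next
  have "\<one> \<in> center" by (simp add: center_def)
  then show "center \<noteq> {}" by blast
qed (rule center_carrier)

lemma center_subset_centralizer: "g \<in> carrier G \<Longrightarrow> center \<subseteq> centralizer g"
  by (auto simp: center_def centralizer_def)

lemma noncentral_centralizer: "g \<in> carrier G \<Longrightarrow> g \<notin> center \<Longrightarrow> centralizer g \<noteq> carrier G"
  by (auto simp: center_def centralizer_def set_eq_iff)

lemma conj_by_center: "g \<in> carrier G \<Longrightarrow> x \<in> center \<Longrightarrow> conj_by g x = x"
  using center_carrier conj_by_fixes_iff center_commute by blast

lemma conj_by_noncentral: "g \<in> carrier G \<Longrightarrow> x \<in> carrier G \<Longrightarrow> x \<notin> center \<Longrightarrow> conj_by g x \<notin> center"
  by (metis conj_by_center conj_by_inv_left(1) inv_closed)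

definition noncentral_centralizers :: "'a set set" where
  "noncentral_centralizers = {centralizer g | g. g \<in> carrier G - center}"

lemma centralizersI [intro]: "g \<in> carrier G \<Longrightarrow> g \<notin> center \<Longrightarrow> centralizer g \<in> noncentral_centralizers"
  by (auto simp: noncentral_centralizers_def)

lemma centralizersE [elim]:
  assumes "B \<in> noncentral_centralizers"
  obtains g where "g \<in> carrier G" "g \<notin> center" "B = centralizer g"
  using assms by (auto simp: noncentral_centralizers_def)

text \<open>
When centralizers of non-central elements are abelian, two of them that share a non-central element
\<open>x\<close> both coincide with the centralizer of \<open>x\<close>.
\<close>
lemma centralizer_blocks:
  assumes ab: "\<And>g x y. g \<in> carrier G - center \<Longrightarrow> x \<in> centralizer g \<Longrightarrow> y \<in> centralizer g \<Longrightarrow> x \<otimes> y = y \<otimes> x"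
  shows "block_system G center noncentral_centralizers"
proof -
  let ?\<B> = "noncentral_centralizers"
  have eq: "centralizer x = centralizer k" if x: "x \<in> centralizer k" "x \<notin> center" and k: "k \<in> carrier G - center" for x k
  proof
    have xG: "x \<in> carrier G" using x centralizer_memD by blast
    show "centralizer k \<subseteq> centralizer x" using ab[OF k] x xG by (auto simp: centralizer_def)
    have "k \<in> centralizer x" using centralizer_sym x k by blast
    moreover have "x \<in> carrier G - center" using x xG by blast
    ultimately show "centralizer x \<subseteq> centralizer k" using ab[of x] centralizer_memD(1) unfolding centralizer_def[of k] by blast
  qed
  show ?thesis
  proof (intro block_system.intro block_system_axioms.intro)
    show "finite_group G" by (rule finite_group_axioms)
  next
    fix B h assume "B \<in> ?\<B>" and h: "h \<in> carrier G"
    then obtain g where g: "g \<in> carrier G" "g \<notin> center" "B = centralizer g" by blast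
    then show "conj_by h ` B \<in> ?\<B>"
      using h centralizer_conj_by[of h g] conj_by_noncentral[of h g] by (metis centralizersI conj_by_closed)
  next
    fix B C assume B: "B \<in> ?\<B>" "C \<in> ?\<B>" "B \<noteq> C"
    then obtain g h where g: "g \<in> carrier G - center" "B = centralizer g" and h: "h \<in> carrier G - center" "C = centralizer h" by blast
    show "B \<inter> C \<subseteq> center"
    proof
      fix x assume x: "x \<in> B \<inter> C"
      show "x \<in> center"
      proof (rule ccontr)
        assume "x \<notin> center"
        then have "centralizer x = centralizer g" "centralizer x = centralizer h" using eq x g h by auto
        then show False using g h B(3) by simp
      qed
    qed
  next
    fix B assume "B \<in> ?\<B>"
    then obtain g where g: "g \<in> carrier G" "g \<notin> center" "B = centralizer g" by blast
    then show "center \<subset> B" using center_subset_centralizer[of g] centralizer_self[of g] by blast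
    show "subgroup B G" using g by (simp add: subgroup_centralizer)
  next
    fix g assume "g \<in> carrier G - center"
    then show "\<exists>B\<in>?\<B>. g \<in> B" using centralizer_self by blast
  qed (rule center_subgroup)
qed

lemma not_all_centralizers_self_normalizing:
  assumes ab: "\<And>g x y. g \<in> carrier G - center \<Longrightarrow> x \<in> centralizer g \<Longrightarrow> y \<in> centralizer g \<Longrightarrow> x \<otimes> y = y \<otimes> x"
    and N: "\<And>g. g \<in> carrier G - center \<Longrightarrow> normalizer G (centralizer g) = centralizer g"
    and nc: "center \<noteq> carrier G"
  shows False
proof -
  interpret block_system G center "noncentral_centralizers"
    using centralizer_blocks ab by blast
  obtain g where g: "g \<in> carrier G - center" using nc center_carrier by blast
  show False
    by (rule not_all_self_normalizing[of "centralizer g"]) (use g noncentral_centralizer N in auto)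
qed

end

text \<open>
The situation to which a non-solvable minimal PF-group reduces. Assumption \<open>core\<close> gives each
proper subgroup containing \<open>z\<close> a cyclic subgroup containing \<open>z\<close> outside which
\<open>p\<close>-th powers vanish, and \<open>no_core\<close> denies this for \<open>G\<close>. The goal is a
contradiction.
\<close>
locale cored_group = finite_group +
  fixes p :: nat and z :: 'a
  assumes prime_p: "prime p"
    and z_closed: "z \<in> carrier G" and z_ne: "z \<noteq> \<one>" and z_pow: "z [^] p = \<one>"
    and z_central: "g \<in> carrier G \<Longrightarrow> g \<otimes> z = z \<otimes> g"
    and core: "subgroup M G \<Longrightarrow> M \<noteq> carrier G \<Longrightarrow> z \<in> M \<Longrightarrow>
      \<exists>c\<in>M. z \<in> cyc c \<and> (\<forall>y\<in>M. y \<notin> cyc c \<longrightarrow> y [^] p = \<one>)"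
    and no_core: "c \<in> carrier G \<Longrightarrow> z \<in> cyc c \<Longrightarrow> \<exists>y\<in>carrier G. y \<notin> cyc c \<and> y [^] p \<noteq> \<one>"
    and unsolvable: "\<not> solvable_seq G (carrier G)"
begin

lemma z_in_center: "z \<in> center"
  using z_closed z_central by (auto simp: center_def)

lemma z_in_centralizer: "g \<in> carrier G \<Longrightarrow> z \<in> centralizer g"
  using z_in_center center_subset_centralizer by blast

lemma nonabelian: "center \<noteq> carrier G"
proof
  assume "center = carrier G"
  then have "solvable_seq G (carrier G)"
    by (intro solvable_commute subgroup_self center_commute) auto
  then show False using unsolvable by blast
qed

lemma not_prime_power_exponent: "\<exists>x\<in>carrier G. x [^] (p ^ k) \<noteq> \<one>"
proof (rule ccontr)
  assume "\<not> ?thesis"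
  then obtain n where "card (carrier G) = p ^ n"
    using prime_power_exponent[OF subgroup_self prime_p, of k] by blast
  then show False using solvable_prime_power[OF prime_p subgroup_self] unsolvable by blast
qed

text \<open>
The use made of non-solvability: a solvable normal subgroup together with one element stays inside a proper
subgroup, which then has a core.
\<close>
lemma not_adjoin_normal:
  assumes "subgroup D G" "solvable_seq G D" "normalizer G D = carrier G" "c \<in> carrier G"
  shows "subgroup (adjoin D c) G" "D \<subseteq> adjoin D c" "c \<in> adjoin D c" "adjoin D c \<noteq> carrier G"
proof -
  have n: "conj_by c d \<in> D" if "d \<in> D" for d
    using normalizer_memD(2)[of c D] assms that subgroup.subset by blast
  show "subgroup (adjoin D c) G" "D \<subseteq> adjoin D c" "c \<in> adjoin D c"
    using adjoin_subgroup[OF assms(1,4) n] by auto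
  show "adjoin D c \<noteq> carrier G" using solvable_adjoin[OF assms(1,4) n assms(2)] unsolvable by metis
qed

lemma root_in_cyclic:
  assumes "c \<in> carrier G" "z \<in> cyc c" "x \<in> cyc c" "x [^] p = \<one>" shows "x \<in> cyc z"
proof -
  obtain k where "x = z [^] (k::nat)"
    using cyclic_prime_roots[OF assms(1) prime_p assms(2) z_ne z_pow assms(3,4)] by metis
  then show ?thesis using z_closed cyc_nat by auto
qed

lemma pow_cyc_z: "x \<in> cyc z \<Longrightarrow> x [^] p = \<one>"
  using z_closed z_pow cyc_nat by (auto simp: nat_pow_pow) (metis mult.commute nat_pow_one nat_pow_pow)

lemma cyc_z_center: "cyc z \<subseteq> center"
  using z_in_center center_subgroup cyc_least by blast

lemma ord_z: "ord z = p"
proof -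
  have "ord z dvd p" using z_pow z_closed pow_eq_id by blast
  moreover have "ord z \<noteq> 1" using z_ne z_closed ord_eq_1 by blast
  ultimately show ?thesis using prime_p prime_nat_iff by blast
qed

lemma card_cyc_z: "card (cyc z) = p"
  using generate_pow_card[OF z_closed] ord_z by simp

lemma centralizer_proper: "g \<in> carrier G \<Longrightarrow> g \<notin> center \<Longrightarrow> 
   subgroup (centralizer g) G \<and> centralizer g \<noteq> carrier G \<and> z \<in> centralizer g"
  using subgroup_centralizer noncentral_centralizer z_in_centralizer by blast

text \<open>
Suppose \<open>u\<close> is central and not a power of \<open>z\<close>. Multiplying elements outside a core
by \<open>u\<close> shows that every proper subgroup containing \<open>z\<close> and \<open>u\<close> is
cyclic or of exponent \<open>p\<close>. An element \<open>a\<close> with \<open>a^p \<noteq> \<one>\<close>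
therefore has a cyclic centralizer, which yields \<open>u^p \<noteq> \<one>\<close> and leaves only the cyclic
case. So all centralizers of non-central elements are cyclic and self-normalizing, which the weights forbid.
\<close>
lemma center_eq_cyc_z: "center = cyc z"
proof (rule ccontr)
  assume "center \<noteq> cyc z"
  then obtain u where u: "u \<in> center" "u \<notin> cyc z" using cyc_z_center by blast
  have uG: "u \<in> carrier G" using u center_carrier by blast
  have I1: "(\<forall>x\<in>M. x [^] p = \<one>) \<or> (\<exists>c\<in>carrier G. M = cyc c)" 
    if M: "subgroup M G" "M \<noteq> carrier G" "z \<in> M" "u \<in> M" for M
  proof -
    obtain c where c: "c \<in> M" "z \<in> cyc c" and out: "\<And>y. y \<in> M \<Longrightarrow> y \<notin> cyc c \<Longrightarrow> y [^] p = \<one>"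
      using core[OF M(1-3)] by blast
    have cG: "c \<in> carrier G" using c M subgroup.mem_carrier by metis
    have cM: "cyc c \<subseteq> M" using cyc_least M c by blast
    show ?thesis
    proof (cases "M = cyc c")
      case False
      then obtain y where y: "y \<in> M" "y \<notin> cyc c" using cM by blast
      have yG: "y \<in> carrier G" using y M subgroup.mem_carrier by metis
      have "u \<notin> cyc c"
      proof
        assume uc: "u \<in> cyc c"
        then have "y \<otimes> u \<notin> cyc c"
          using y yG uG cyc_subgroup[OF cG] by (metis inv_solve_right subgroup.m_closed subgroup.m_inv_closed m_closed)
        moreover have "y \<otimes> u \<in> M" using y M subgroup.m_closed by metis
        ultimately have "(y \<otimes> u) [^] p = \<one>" using out by blast
        then have "u [^] p = \<one>"
          using pow_mult_commute[OF yG uG center_commute[OF u(1) yG], of p] out[OF y] uG by simp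
        then show False using root_in_cyclic[OF cG c(2) uc] u by blast
      qed
      then have up: "u [^] p = \<one>" using out M by blast
      have "x [^] p = \<one>" if x: "x \<in> M" for x
      proof (cases "x \<in> cyc c")
        case True
        have xG: "x \<in> carrier G" using x M subgroup.mem_carrier by metis
        have "x \<otimes> u \<notin> cyc c"
          using True xG uG \<open>u \<notin> cyc c\<close> cyc_subgroup[OF cG] by (metis inv_solve_left subgroup.m_closed subgroup.m_inv_closed m_closed)
        moreover have "x \<otimes> u \<in> M" using x M subgroup.m_closed by metis
        ultimately have "(x \<otimes> u) [^] p = \<one>" using out by blast
        then show ?thesis
          using pow_mult_commute[OF xG uG center_commute[OF u(1) xG], of p] up xG by simp
      qed (use out x in blast)
      then show ?thesis by blast
    qed (use cG in blast)
  qed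
  obtain a where a: "a \<in> carrier G" "a \<notin> center" "a [^] p \<noteq> \<one>"
  proof (rule ccontr)
    assume "\<not> thesis"
    with that have e: "\<And>a. a \<in> carrier G \<Longrightarrow> a \<notin> center \<Longrightarrow> a [^] p = \<one>" by blast
    obtain b where b: "b \<in> carrier G" "b \<notin> center" using nonabelian center_carrier by blast
    have "x [^] p = \<one>" if x: "x \<in> carrier G" for x
    proof (cases "x \<in> center")
      case True
      have "b \<otimes> x \<notin> center"
        using b x True center_subgroup by (metis inv_solve_right subgroup.m_closed subgroup.m_inv_closed m_closed)
      then have "(b \<otimes> x) [^] p = \<one>" using e b x by simp
      then show ?thesis
        using pow_mult_commute[OF b(1) x center_commute[OF True b(1)], of p] e[OF b] x by simp
    qed (use e x in blast)
    then show False using not_prime_power_exponent[of 1] by auto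
  qed
  have "\<exists>c\<in>carrier G. centralizer a = cyc c"
    using I1[of "centralizer a"] centralizer_proper[OF a(1,2)] center_subset_centralizer[OF a(1)] u a centralizer_self[OF a(1)] by blast
  then have up: "u [^] p \<noteq> \<one>"
    using root_in_cyclic[of _ u] u z_in_centralizer[OF a(1)] center_subset_centralizer[OF a(1)] by auto
  have I2: "\<exists>c\<in>carrier G. M = cyc c" if "subgroup M G" "M \<noteq> carrier G" "z \<in> M" "u \<in> M" for M
    using I1[OF that] up that(4) by blast
  have I3: "x \<otimes> y = y \<otimes> x" if "subgroup M G" "M \<noteq> carrier G" "z \<in> M" "u \<in> M" "x \<in> M" "y \<in> M" for M x y
    using I2[OF that(1-4)] cyc_commute that(5,6) by metis
  have cent_I: "subgroup (centralizer g) G" "centralizer g \<noteq> carrier G" "z \<in> centralizer g" "u \<in> centralizer g" 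
    if "g \<in> carrier G - center" for g
    using that centralizer_proper u center_subset_centralizer by blast+
  show False
  proof (rule not_all_centralizers_self_normalizing[OF _ _ nonabelian])
    fix g x y assume g: "g \<in> carrier G - center"
    then show "x \<in> centralizer g \<Longrightarrow> y \<in> centralizer g \<Longrightarrow> x \<otimes> y = y \<otimes> x" using I3[OF cent_I[OF g]] by blast
  next
    fix g assume g: "g \<in> carrier G - center"
    let ?N = "normalizer G (centralizer g)"
    have sub: "centralizer g \<subseteq> ?N" using subset_normalizer cent_I(1)[OF g] by blast
    show "?N = centralizer g"
    proof (cases "?N = carrier G")
      case True
      obtain b where b: "b \<in> carrier G" "b \<notin> centralizer g" 
        using cent_I(1,2)[OF g] subgroup.subset by blast
      have sol: "solvable_seq G (centralizer g)" using cent_I[OF g] I3[OF cent_I[OF g]] solvable_commute by blast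
      note adj = not_adjoin_normal[OF cent_I(1)[OF g] sol True b(1)]
      have "z \<in> adjoin (centralizer g) b" "u \<in> adjoin (centralizer g) b" "g \<in> adjoin (centralizer g) b"
        using adj(2) cent_I[OF g] centralizer_self[of g] g by auto
      then have "b \<otimes> g = g \<otimes> b" using I3[OF adj(1,4)] adj(3) by blast
      then show ?thesis using b by (auto simp: centralizer_def)
    next
      case False
      have "x \<in> centralizer g" if x: "x \<in> ?N" for x
      proof -
        have "x \<otimes> g = g \<otimes> x"
          using I3[OF normalizer_subgroup[OF cent_I(1)[OF g]] False] cent_I[OF g] centralizer_self[of g] sub x g by blast
        moreover have "x \<in> carrier G" using x cent_I(1)[OF g] normalizer_subgroup subgroup.mem_carrier by metis
        ultimately show ?thesis by (auto simp: centralizer_def)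
      qed
      with sub show ?thesis by blast
    qed
  qed
qed

lemma noncentral_of_pow: "a \<in> carrier G \<Longrightarrow> a [^] p \<noteq> \<one> \<Longrightarrow> a \<notin> center"
  using center_eq_cyc_z pow_cyc_z by blast

text \<open>
The core of the centralizer contains \<open>a\<close>. An element \<open>y\<close> outside it would give
\<open>y a\<close> outside it too, and then \<open>a^p = (y a)^p = \<one>\<close>.
\<close>
lemma centralizer_cyclic:
  assumes a: "a \<in> carrier G" "a [^] p \<noteq> \<one>"
  obtains c where "c \<in> carrier G" "centralizer a = cyc c"
proof -
  have an: "a \<notin> center" using noncentral_of_pow[OF a] .
  obtain c where c: "c \<in> centralizer a" "z \<in> cyc c" and out: "\<And>y. y \<in> centralizer a \<Longrightarrow> y \<notin> cyc c \<Longrightarrow> y [^] p = \<one>"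
    using core[of "centralizer a"] centralizer_proper[OF a(1) an] by blast
  have cG: "c \<in> carrier G" using c centralizer_memD by blast
  have ac: "a \<in> cyc c" using out a centralizer_self by blast
  have "cyc c \<subseteq> centralizer a" using cyc_least c subgroup_centralizer a by blast
  moreover have "y \<in> cyc c" if y: "y \<in> centralizer a" for y
  proof (rule ccontr)
    assume yc: "y \<notin> cyc c"
    have yG: "y \<in> carrier G" using y centralizer_memD by blast
    have "y \<otimes> a \<notin> cyc c"
      using yc ac yG a cyc_subgroup[OF cG] by (metis inv_solve_right subgroup.m_closed subgroup.m_inv_closed m_closed)
    moreover have "y \<otimes> a \<in> centralizer a" using y centralizer_self[OF a(1)] subgroup_centralizer[OF a(1)] subgroup.m_closed by metis
    ultimately have "(y \<otimes> a) [^] p = \<one>" using out by blast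
    then show False
      using pow_mult_commute[OF yG a(1) centralizer_memD(2)[OF y], of p] out[OF y yc] a by simp
  qed
  ultimately show ?thesis using that cG by blast
qed

lemma centralizer_cyclic_commute:
  assumes "a \<in> carrier G" "a [^] p \<noteq> \<one>" "x \<in> centralizer a" "y \<in> centralizer a"
  shows "x \<otimes> y = y \<otimes> x"
  using centralizer_cyclic[OF assms(1,2)] cyc_commute assms(3,4) by metis

text \<open>
The element \<open>t\<close> is outside the core of its centralizer, since a cyclic group containing
\<open>z\<close> has no solutions of \<open>x^p = \<one>\<close> besides the powers of \<open>z\<close>. So
for \<open>y\<close> in the core \<open>y t\<close> is outside, and \<open>y^p = (y t)^p = \<one>\<close>.
\<close>
lemma centralizer_exponent:
  assumes t: "t \<in> carrier G" "t \<notin> center" "t [^] p = \<one>" and y: "y \<in> centralizer t"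
  shows "y [^] p = \<one>"
proof -
  obtain c where c: "c \<in> centralizer t" "z \<in> cyc c" and out: "\<And>y. y \<in> centralizer t \<Longrightarrow> y \<notin> cyc c \<Longrightarrow> y [^] p = \<one>"
    using core[of "centralizer t"] centralizer_proper[OF t(1,2)] by blast
  have cG: "c \<in> carrier G" using c centralizer_memD by blast
  have tc: "t \<notin> cyc c" using root_in_cyclic[OF cG c(2)] t center_eq_cyc_z by blast
  show ?thesis
  proof (cases "y \<in> cyc c")
    case True
    have yG: "y \<in> carrier G" using y centralizer_memD by blast
    have "y \<otimes> t \<notin> cyc c"
      using tc True yG t cyc_subgroup[OF cG] by (metis inv_solve_left subgroup.m_closed subgroup.m_inv_closed m_closed)
    moreover have "y \<otimes> t \<in> centralizer t" using y centralizer_self[OF t(1)] subgroup_centralizer[OF t(1)] subgroup.m_closed by metis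
    ultimately have "(y \<otimes> t) [^] p = \<one>" using out by blast
    then show ?thesis
      using pow_mult_commute[OF yG t(1) centralizer_memD(2)[OF y], of p] t yG by simp
  qed (use out y in blast)
qed

text \<open>
Adjoin to a normal cyclic centralizer an element \<open>b\<close> outside it with \<open>b^p \<noteq>
\<one>\<close>. The result is proper, so its core contains \<open>a\<close> and \<open>b\<close>, which
therefore commute.
\<close>
lemma centralizer_cyclic_not_normal:
  assumes a: "a \<in> carrier G" "a [^] p \<noteq> \<one>"
  shows "normalizer G (centralizer a) \<noteq> carrier G"
proof
  assume N: "normalizer G (centralizer a) = carrier G"
  obtain c where c: "c \<in> carrier G" "centralizer a = cyc c" using centralizer_cyclic[OF a] .
  obtain b where b: "b \<in> carrier G" "b \<notin> centralizer a" "b [^] p \<noteq> \<one>"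
    using no_core[OF c(1)] c(2) z_in_centralizer[OF a(1)] by metis
  have sg: "subgroup (centralizer a) G" using a subgroup_centralizer by blast
  have sol: "solvable_seq G (centralizer a)" using sg centralizer_cyclic_commute[OF a] solvable_commute by blast
  note adj = not_adjoin_normal[OF sg sol N b(1)]
  obtain d where d: "d \<in> adjoin (centralizer a) b" and out: "\<And>y. y \<in> adjoin (centralizer a) b \<Longrightarrow> y \<notin> cyc d \<Longrightarrow> y [^] p = \<one>"
    using core[OF adj(1,4)] adj(2) z_in_centralizer[OF a(1)] by blast
  have dG: "d \<in> carrier G" using d adj(1) subgroup.mem_carrier by metis
  have "a \<in> cyc d" "b \<in> cyc d" using out adj centralizer_self[OF a(1)] a b by blast+
  then have "b \<otimes> a = a \<otimes> b" using cyc_commute dG by blast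
  then show False using b by (auto simp: centralizer_def)
qed

lemma normalizer_centralizer_cyclic:
  assumes a: "a \<in> carrier G" "a [^] p \<noteq> \<one>" and y: "y \<in> normalizer G (centralizer a)" "y \<notin> centralizer a"
  shows "y [^] p = \<one>"
proof -
  let ?N = "normalizer G (centralizer a)"
  have sg: "subgroup (centralizer a) G" using a subgroup_centralizer by blast
  have sub: "centralizer a \<subseteq> ?N" using subset_normalizer[OF sg] .
  have sN: "subgroup ?N G" using normalizer_subgroup[OF sg] .
  obtain d where d: "d \<in> ?N" and out: "\<And>y. y \<in> ?N \<Longrightarrow> y \<notin> cyc d \<Longrightarrow> y [^] p = \<one>"
    using core[OF sN centralizer_cyclic_not_normal[OF a]] sub z_in_centralizer[OF a(1)] by blast
  have dG: "d \<in> carrier G" using d sN subgroup.mem_carrier by metis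
  have "a \<in> cyc d" using out sub centralizer_self[OF a(1)] a by blast
  then have "cyc d \<subseteq> centralizer a"
    using cyc_commute[OF dG] generate_in_carrier[of "{d}"] dG by (auto simp: centralizer_def)
  then show ?thesis using out y by blast
qed

text \<open>
Otherwise every block is a cyclic centralizer, and nothing outside it can normalize it because such an element
would be a non-central root.
\<close>
lemma noncentral_root_exists: "\<exists>t\<in>carrier G - center. t [^] p = \<one>"
proof (rule ccontr)
  assume no: "\<not> ?thesis"
  show False
  proof (rule not_all_centralizers_self_normalizing[OF _ _ nonabelian])
    fix g x y assume "g \<in> carrier G - center"
    then show "x \<in> centralizer g \<Longrightarrow> y \<in> centralizer g \<Longrightarrow> x \<otimes> y = y \<otimes> x" using no centralizer_cyclic_commute by blast
  next
    fix g assume g: "g \<in> carrier G - center"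
    have sg: "subgroup (centralizer g) G" using g subgroup_centralizer by blast
    have "y \<in> centralizer g" if y: "y \<in> normalizer G (centralizer g)" for y
    proof (rule ccontr)
      assume yc: "y \<notin> centralizer g"
      have "y [^] p = \<one>" using normalizer_centralizer_cyclic[OF _ _ y yc] g no by blast
      moreover have "y \<in> carrier G - center"
        using y yc g center_subset_centralizer subgroup.mem_carrier[OF normalizer_subgroup[OF sg]] by blast
      ultimately show False using no by blast
    qed
    then show "normalizer G (centralizer g) = centralizer g" using subset_normalizer[OF sg] by blast
  qed
qed

lemma not_in_cyclic: "t \<in> carrier G \<Longrightarrow> t \<notin> center \<Longrightarrow> t [^] p = \<one> \<Longrightarrow> c \<in> carrier G \<Longrightarrow> z \<in> cyc c \<Longrightarrow> t \<notin> cyc c"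
  using root_in_cyclic center_eq_cyc_z by blast

lemma centralizer_cyclic_self:
  assumes a: "a \<in> carrier G" "a [^] p \<noteq> \<one>" and x: "x \<in> centralizer a" "x \<notin> center"
  shows "x [^] p \<noteq> \<one>" 
proof -
  obtain c where c: "c \<in> carrier G" "centralizer a = cyc c" using centralizer_cyclic[OF a] .
  then show ?thesis using not_in_cyclic[of x c] x centralizer_memD z_in_centralizer[OF a(1)] by blast
qed

end

section \<open>The even prime\<close>

context finite_group
begin

lemma card_two_cosets:
  assumes A: "subgroup A G" and M: "subgroup M G" and AM: "A \<subseteq> M" and y: "y \<in> M - A"
    and prod: "\<And>w. w \<in> M - A \<Longrightarrow> y \<otimes> w \<in> A"
  shows "card M = 2 * card A"
proof -
  have MG: "M \<subseteq> carrier G" and AG: "A \<subseteq> carrier G" using A M subgroup.subset by blast+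
  have yG: "y \<in> carrier G" using y MG by blast
  have "M - A = (\<lambda>x. inv y \<otimes> x) ` A"
  proof
    show "M - A \<subseteq> (\<lambda>x. inv y \<otimes> x) ` A"
    proof
      fix w assume w: "w \<in> M - A"
      then have "w = inv y \<otimes> (y \<otimes> w)" using yG MG by (auto simp: inv_cancel_left)
      then show "w \<in> (\<lambda>x. inv y \<otimes> x) ` A" using prod[OF w] by blast
    qed
    show "(\<lambda>x. inv y \<otimes> x) ` A \<subseteq> M - A"
    proof clarify
      fix x assume x: "x \<in> A"
      have "inv y \<in> M" using y subgroup.m_inv_closed[OF M] by blast
      then have "inv y \<otimes> x \<in> M" using x AM subgroup.m_closed[OF M] by blast
      moreover have "inv y \<otimes> x \<notin> A"
      proof
        assume "inv y \<otimes> x \<in> A"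
        then have "x \<otimes> inv (inv y \<otimes> x) \<in> A" using subgroup.m_closed[OF A x] subgroup.m_inv_closed[OF A] by blast
        moreover have "x \<otimes> inv (inv y \<otimes> x) = y" using x AG yG by (auto simp: inv_mult_group inv_cancel_left subset_iff)
        ultimately show False using y by simp
      qed
      ultimately show "inv y \<otimes> x \<in> M - A" by blast
    qed
  qed
  moreover have "inj_on (\<lambda>x. inv y \<otimes> x) A"
    using yG AG by (auto simp: inj_on_def subset_iff)
  ultimately have "card (M - A) = card A" by (simp add: card_image)
  moreover have "card (M - A) = card M - card A" using card_Diff_subset[OF finite_sub[OF AG] AM] .
  moreover have "card A > 0" using card_subgroup_pos[OF A] .
  ultimately show ?thesis by simp
qed

lemma square_prod_inverts:
  assumes "y \<in> carrier G" "x \<in> carrier G" "y [^] (2::nat) = \<one>" "(y \<otimes> x) [^] (2::nat) = \<one>"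
  shows "conj_by y x = inv x"
proof -
  have y: "y \<otimes> y = \<one>" and yx: "y \<otimes> x \<otimes> (y \<otimes> x) = \<one>" using assms by (simp_all add: numeral_2_eq_2)
  have "y \<otimes> x \<otimes> y \<otimes> x = \<one>" using yx assms by (simp add: m_assoc)
  then have "inv x = y \<otimes> x \<otimes> y" using assms by (metis inv_equality m_closed)
  moreover have "inv y = y" using y assms inv_equality by blast
  ultimately show ?thesis by (simp add: conj_by_def)
qed

lemma exponent_two_commute:
  assumes "x \<in> carrier G" "y \<in> carrier G" "x [^] (2::nat) = \<one>" "y [^] (2::nat) = \<one>" "(x \<otimes> y) [^] (2::nat) = \<one>"
  shows "x \<otimes> y = y \<otimes> x"
proof -
  have "inv x = x" "inv y = y" "inv (x \<otimes> y) = x \<otimes> y"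
    using assms inv_equality by (simp_all add: numeral_2_eq_2)
  then show ?thesis using assms inv_mult_group by metis
qed

end

locale even_cored_group = cored_group +
  assumes p2: "p = 2"
begin

lemma exponent_two_centralizer:
  assumes t: "t \<in> carrier G" "t \<notin> center" "t [^] p = \<one>" and "x \<in> centralizer t" "y \<in> centralizer t"
  shows "x \<otimes> y = y \<otimes> x"
proof -
  have "x \<otimes> y \<in> centralizer t" using assms subgroup_centralizer subgroup.m_closed by metis
  then show ?thesis
    using exponent_two_commute centralizer_exponent[OF t] assms centralizer_memD p2 by metis
qed

sublocale block_system G center "noncentral_centralizers"
proof (rule centralizer_blocks)
  fix g x y assume g: "g \<in> carrier G - center" "x \<in> centralizer g" "y \<in> centralizer g"
  show "x \<otimes> y = y \<otimes> x"
  proof (cases "g [^] p = \<one>")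
    case True
    then show ?thesis using exponent_two_centralizer[of g x y] g by blast
  next
    case False
    then show ?thesis using centralizer_cyclic_commute[of g x y] g by blast
  qed
qed

lemma card_center: "card center = 2"
  using center_eq_cyc_z card_cyc_z p2 by simp

text \<open>
Both \<open>y\<close> and \<open>y x\<close> are outside the block, hence square to \<open>\<one>\<close>.
\<close>
lemma normalizer_inverts:
  assumes a: "a \<in> carrier G" "a [^] p \<noteq> \<one>" and y: "y \<in> normalizer G (centralizer a)" "y \<notin> centralizer a"
    and x: "x \<in> centralizer a"
  shows "conj_by y x = inv x"
proof -
  have sg: "subgroup (centralizer a) G" using a subgroup_centralizer by blast
  have N: "subgroup (normalizer G (centralizer a)) G" using normalizer_subgroup[OF sg] .
  have yG: "y \<in> carrier G" and xG: "x \<in> carrier G" using y x centralizer_memD subgroup.mem_carrier[OF N] by blast+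
  have "y \<otimes> x \<notin> centralizer a" using mult_not_in_subgroup(1)[OF sg yG y(2) x] .
  moreover have "y \<otimes> x \<in> normalizer G (centralizer a)" using y x subset_normalizer[OF sg] subgroup.m_closed[OF N] by blast
  ultimately show ?thesis
    using square_prod_inverts[OF yG xG] normalizer_centralizer_cyclic[OF a] y p2 by metis
qed

lemma inverts_twice_commutes:
  assumes "y \<in> carrier G" "w \<in> carrier G" "x \<in> carrier G" "conj_by y x = inv x" "conj_by w x = inv x"
  shows "y \<otimes> w \<in> centralizer x"
proof -
  have "conj_by (y \<otimes> w) x = conj_by y (inv x)" using assms by (simp add: conj_by_conj_by[symmetric])
  also have "\<dots> = x" using assms by (simp add: conj_by_inv)
  finally show ?thesis using assms conj_by_fixes_iff by (simp add: centralizer_def)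
qed

lemma card_normalizer_centralizer:
  assumes a: "a \<in> carrier G" "a [^] p \<noteq> \<one>" and ne: "normalizer G (centralizer a) \<noteq> centralizer a"
  shows "card (normalizer G (centralizer a)) = 2 * card (centralizer a)"
proof -
  have sg: "subgroup (centralizer a) G" using a subgroup_centralizer by blast
  have N: "subgroup (normalizer G (centralizer a)) G" using normalizer_subgroup[OF sg] .
  have sub: "centralizer a \<subseteq> normalizer G (centralizer a)" using subset_normalizer[OF sg] .
  obtain y where y: "y \<in> normalizer G (centralizer a) - centralizer a" using ne sub by blast
  show ?thesis
  proof (rule card_two_cosets[OF sg N sub y])
    fix w assume w: "w \<in> normalizer G (centralizer a) - centralizer a"
    have "conj_by y a = inv a" "conj_by w a = inv a" using normalizer_inverts[OF a _ _ centralizer_self[OF a(1)]] y w by blast+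
    then show "y \<otimes> w \<in> centralizer a"
      using inverts_twice_commutes[of y w a] y w a subgroup.mem_carrier[OF N] by blast
  qed
qed

text \<open>
Take a second conjugate of the block. Its normalizer meets the block only in \<open>Z\<close>, because a
normalizing element outside the conjugate is an involution and a cyclic group has only one. So the powers
\<open>c^i\<close> with \<open>i < n\<close> of a generator \<open>c\<close> lie in different cosets of that
normalizer.
\<close>
lemma normalizer_square_bound:
  assumes a: "a \<in> carrier G" "a [^] p \<noteq> \<one>" and n: "card (centralizer a) = n * 2"
  shows "n * card (normalizer G (centralizer a)) \<le> order G"
proof -
  obtain c where c: "c \<in> carrier G" "centralizer a = cyc c" using centralizer_cyclic[OF a] .
  have sg: "subgroup (centralizer a) G" using a subgroup_centralizer by blast
  have AG: "centralizer a \<subseteq> carrier G" using centralizer_memD by blast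
  have "normalizer G (centralizer a) \<noteq> carrier G" using centralizer_cyclic_not_normal[OF a] .
  then obtain g where g: "g \<in> carrier G" "g \<notin> normalizer G (centralizer a)"
    using normalizer_subgroup[OF sg] subgroup.subset by blast
  define b where "b = conj_by g a"
  have b: "b \<in> carrier G" "b [^] p \<noteq> \<one>" 
    using a g conj_by_pow[of g a p] conj_by_inv_left(1)[of g "a [^] p"] by (auto simp: b_def)
  have cb: "centralizer b = conj_by g ` centralizer a" unfolding b_def using centralizer_conj_by g a by blast
  then have ne: "centralizer b \<noteq> centralizer a" using g AG by (auto simp: normalizer_eq)
  have sgb: "subgroup (centralizer b) G" using b subgroup_centralizer by blast
  have Nb: "subgroup (normalizer G (centralizer b)) G" using normalizer_subgroup[OF sgb] .
  have meet: "x \<in> center" if x: "x \<in> centralizer a" "x \<in> normalizer G (centralizer b)" for x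
  proof (rule ccontr)
    assume xc: "x \<notin> center"
    then have "x [^] p \<noteq> \<one>" using centralizer_cyclic_self[OF a x(1)] by blast
    then have "x \<in> centralizer b" using normalizer_centralizer_cyclic[OF b x(2)] by blast
    moreover have "centralizer a \<inter> centralizer b \<subseteq> center"
      using block_meet[of "centralizer a" "centralizer b"] ne noncentral_of_pow a b by blast
    ultimately show False using x xc by blast
  qed
  have cN: "card (normalizer G (centralizer b)) = card (normalizer G (centralizer a))"
  proof -
    have "centralizer a \<in> noncentral_centralizers" "centralizer b \<in> noncentral_centralizers"
      using a b noncentral_of_pow by blast+
    have "normalizer G (centralizer b) = conj_by g ` normalizer G (centralizer a)"
    proof -
      have *: "conj_by h ` normalizer G S \<subseteq> normalizer G (conj_by h ` S)" if h: "h \<in> carrier G" "S \<subseteq> carrier G" for h S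
      proof clarify
        fix y assume "y \<in> normalizer G S"
        then have y: "y \<in> carrier G" "conj_by y ` S = S" using h by (auto simp: normalizer_eq)
        have "conj_by (conj_by h y) ` conj_by h ` S = conj_by h ` conj_by y ` S"
          using h y by (subst (1 2) conj_by_image_conj_by) (auto simp: conj_by_def[of h y] m_assoc)
        then show "conj_by h y \<in> normalizer G (conj_by h ` S)"
          using h y conj_by_image_carrier[of h S] by (simp add: normalizer_eq)
      qed
      have "normalizer G (centralizer b) = conj_by g ` conj_by (inv g) ` normalizer G (centralizer b)"
        using conj_by_image_conj_by[of g "inv g" "normalizer G (centralizer b)"] g conj_by_image_one subgroup.subset[OF Nb] by simp
      also have "\<dots> \<subseteq> conj_by g ` normalizer G (conj_by (inv g) ` centralizer b)"
        using *[of "inv g" "centralizer b"] g subgroup.subset[OF sgb] by (intro image_mono) auto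
      also have "conj_by (inv g) ` centralizer b = centralizer a" using conj_by_image_inv[OF g(1) AG cb[symmetric]] .
      finally show ?thesis using *[OF g(1) AG] cb by auto
    qed
    then show ?thesis using card_conj_by_image[OF g(1)] subgroup.subset[OF normalizer_subgroup[OF sg]] by simp
  qed
  have ordc: "ord c = 2 * n" using generate_pow_card[OF c(1)] c(2) n by simp
  let ?f = "\<lambda>(i :: nat, y). y \<otimes> c [^] i"
  have aux: "i = j" if "i \<le> j" "j < n" "y \<in> normalizer G (centralizer b)" "w \<in> normalizer G (centralizer b)" "y \<otimes> c [^] i = w \<otimes> c [^] j" for i j y w
  proof -
    have yw: "y \<in> carrier G" "w \<in> carrier G" using that subgroup.mem_carrier[OF Nb] by blast+
    have "c [^] j = c [^] (j - i) \<otimes> c [^] i" using c that by (simp add: nat_pow_mult)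
    then have "y \<otimes> c [^] i = (w \<otimes> c [^] (j - i)) \<otimes> c [^] i" using that yw c by (simp add: m_assoc)
    then have "y = w \<otimes> c [^] (j - i)" using yw c by (meson m_closed nat_pow_closed right_cancel)
    then have "c [^] (j - i) = inv w \<otimes> y" using yw c by (simp add: inv_cancel_left)
    then have "c [^] (j - i) \<in> normalizer G (centralizer b)"
      using that Nb by (simp add: subgroup.m_closed subgroup.m_inv_closed)
    moreover have "c [^] (j - i) \<in> centralizer a" using c subgroup_nat_pow_closed[OF sg] cyc_self by metis
    ultimately have "c [^] (j - i) \<in> center" using meet by blast
    then have "(c [^] (j - i)) [^] p = \<one>" using center_eq_cyc_z pow_cyc_z by blast
    then have "ord c dvd (j - i) * 2" using c p2 by (simp add: nat_pow_pow pow_eq_id)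
    then have "n dvd j - i" using ordc by (simp add: mult.commute)
    then show "i = j" using that by (auto dest: dvd_imp_le)
  qed
  have inj: "inj_on ?f ({..<n} \<times> normalizer G (centralizer b))"
  proof (rule inj_onI, clarsimp)
    fix i y j w assume *: "i < n" "y \<in> normalizer G (centralizer b)" "j < n" "w \<in> normalizer G (centralizer b)" "y \<otimes> c [^] i = w \<otimes> c [^] j"
    have "i = j" using aux[of i j y w] aux[of j i w y] * by (metis nat_le_linear)
    moreover have "y = w" using * \<open>i = j\<close> c subgroup.mem_carrier[OF Nb] by (meson nat_pow_closed right_cancel)
    ultimately show "i = j \<and> y = w" by blast
  qed
  have "card ({..<n} \<times> normalizer G (centralizer b)) \<le> card (carrier G)"
    by (rule card_inj_on_le[OF inj]) (use c subgroup.mem_carrier[OF Nb] fin in auto)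
  then show ?thesis using cN by (simp add: card_cartesian_product order_def)
qed

text \<open>
The element \<open>t\<close> lies outside the core of \<open>M\<close> and hence inverts \<open>c\<close>.
Then \<open>c t c^-1 t = c^2\<close> belongs to the centralizer of \<open>t\<close>, which has exponent two,
so \<open>c^4 = \<one>\<close>.
\<close>
lemma normalizer_root_centralizer:
  assumes t: "t \<in> carrier G" "t \<notin> center" "t [^] p = \<one>"
    and M: "subgroup M G" "M \<noteq> carrier G" "centralizer t \<subseteq> M" "M \<subseteq> normalizer G (centralizer t)"
    and c: "c \<in> M" "c [^] p \<noteq> \<one>"
  shows "conj_by t c = inv c" "c [^] (p ^ 2) = \<one>"
proof -
  have tM: "t \<in> M" using M centralizer_self t by blast
  have cG: "c \<in> carrier G" using c M subgroup.mem_carrier by metis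
  obtain d where d: "d \<in> M" "z \<in> cyc d" and out: "\<And>y. y \<in> M \<Longrightarrow> y \<notin> cyc d \<Longrightarrow> y [^] p = \<one>"
    using core[OF M(1,2)] M(3) z_in_centralizer[OF t(1)] by blast
  have dG: "d \<in> carrier G" using d M subgroup.mem_carrier by metis
  have cd: "c \<in> cyc d" using out c by blast
  have "t \<otimes> c \<notin> cyc d"
    using mult_not_in_subgroup(1)[OF cyc_subgroup[OF dG] t(1) _ cd] not_in_cyclic[OF t dG d(2)] by blast
  moreover have "t \<otimes> c \<in> M" using tM c M subgroup.m_closed by metis
  ultimately have "(t \<otimes> c) [^] p = \<one>" using out by blast
  then show inv: "conj_by t c = inv c" using square_prod_inverts[OF t(1) cG] t p2 by simp
  have cE: "centralizer t \<subseteq> carrier G" using centralizer_memD by blast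
  have "conj_by c t \<in> centralizer t" using normalizer_memD(2)[OF _ cE, of c t] M c centralizer_self t by blast
  moreover have "t \<in> centralizer t" using centralizer_self t by blast
  ultimately have "conj_by c t \<otimes> t \<in> centralizer t" using subgroup_centralizer[OF t(1)] subgroup.m_closed by metis
  moreover have "conj_by c t \<otimes> t = c \<otimes> c"
  proof -
    have "inv t = t" using t p2 inv_equality by (simp add: numeral_2_eq_2)
    then have "conj_by c t \<otimes> t = c \<otimes> conj_by t (inv c)" using t cG by (simp add: conj_by_def m_assoc)
    also have "conj_by t (inv c) = c" using inv t cG by (simp add: conj_by_inv)
    finally show ?thesis .
  qed
  ultimately have "(c \<otimes> c) [^] p = \<one>" using centralizer_exponent[OF t] by metis
  then have "(c [^] p) [^] p = \<one>" using p2 cG by (simp add: numeral_2_eq_2)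
  then show "c [^] (p ^ 2) = \<one>" using cG by (simp add: nat_pow_pow power2_eq_square)
qed

text \<open>
If the centralizer of \<open>t\<close> were normal, every element could be adjoined to it and would have order
dividing \<open>4\<close>, and \<open>G\<close> would be a \<open>2\<close>-group.
\<close>
lemma root_centralizer_not_normal:
  assumes t: "t \<in> carrier G" "t \<notin> center" "t [^] p = \<one>"
  shows "normalizer G (centralizer t) \<noteq> carrier G"
proof
  assume N: "normalizer G (centralizer t) = carrier G"
  have sg: "subgroup (centralizer t) G" using t subgroup_centralizer by blast
  have sol: "solvable_seq G (centralizer t)" using solvable_commute[OF sg exponent_two_centralizer[OF t]] .
  have "c [^] (p ^ 2) = \<one>" if c: "c \<in> carrier G" for c
  proof (cases "c [^] p = \<one>")
    case True
    then show ?thesis using c by (simp add: power2_eq_square nat_pow_pow[symmetric])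
  next
    case False
    note adj = not_adjoin_normal[OF sg sol N c]
    show ?thesis
      by (rule normalizer_root_centralizer(2)[OF t adj(1,4,2) _ adj(3) False]) (use N adj(1) subgroup.subset in blast)
  qed
  then show False using not_prime_power_exponent[of 2] by blast
qed

lemma four_dvd_root_centralizer:
  assumes t: "t \<in> carrier G" "t \<notin> center" "t [^] p = \<one>"
  shows "4 dvd card (centralizer t)"
proof -
  have sg: "subgroup (centralizer t) G" using t subgroup_centralizer by blast
  obtain k where k: "card (centralizer t) = 2 ^ k"
    using prime_power_exponent[OF sg prime_p, of 1] centralizer_exponent[OF t] p2 by auto
  have "center \<subset> centralizer t" using center_subset_centralizer[OF t(1)] centralizer_self[OF t(1)] t by blast
  then have "card center < card (centralizer t)" using finite_sub psubset_card_mono centralizer_memD by (metis subsetI)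
  then have "(2::nat) ^ 1 < 2 ^ k" using k card_center by simp
  then have "2 \<le> k" by (metis Suc_1 Suc_leI one_less_numeral_iff power_less_imp_less_exp semiring_norm(76))
  then have "(2::nat) ^ 2 dvd 2 ^ k" by (rule le_imp_power_dvd)
  then show ?thesis using k by simp
qed

text \<open>
The normalizer has a core generated by an element \<open>d\<close> of order \<open>4\<close>, inverted by
everything outside, so it is dihedral of order \<open>8\<close>. The last claim supplies the cyclic block
around \<open>d\<close>, which \<open>t\<close> normalizes; its order is needed in the weight equation because
it makes the index of the center in it even.
\<close>
lemma root_centralizer_not_self_normalizing:
  assumes t: "t \<in> carrier G" "t \<notin> center" "t [^] p = \<one>"
    and ne: "normalizer G (centralizer t) \<noteq> centralizer t"
  shows "card (centralizer t) = 4" "card (normalizer G (centralizer t)) = 8"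
    "\<exists>a\<in>carrier G. a [^] p \<noteq> \<one> \<and> 4 dvd card (centralizer a) \<and> normalizer G (centralizer a) \<noteq> centralizer a"
proof -
  let ?N = "normalizer G (centralizer t)"
  have sg: "subgroup (centralizer t) G" using t subgroup_centralizer by blast
  have N: "subgroup ?N G" using normalizer_subgroup[OF sg] .
  have sub: "centralizer t \<subseteq> ?N" using subset_normalizer[OF sg] .
  have Np: "?N \<noteq> carrier G" using root_centralizer_not_normal[OF t] .
  have tN: "t \<in> ?N" using sub centralizer_self t by blast
  have zN: "z \<in> ?N" using sub z_in_centralizer t by blast
  obtain y where y: "y \<in> ?N" "y \<notin> centralizer t" using ne sub by blast
  obtain c where c: "c \<in> ?N" "c [^] p \<noteq> \<one>"
  proof (rule ccontr)
    assume "\<not> thesis"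
    with that have e: "\<And>c. c \<in> ?N \<Longrightarrow> c [^] p = \<one>" by blast
    have yG: "y \<in> carrier G" using y subgroup.mem_carrier[OF N] by blast
    have "y \<otimes> t \<in> ?N" using y tN subgroup.m_closed[OF N] by blast
    then have "y \<otimes> t = t \<otimes> y"
      using exponent_two_commute[OF yG t(1)] e[OF y(1)] e[OF tN] e p2 by blast
    then show False using y yG by (simp add: centralizer_def)
  qed
  obtain d where d: "d \<in> ?N" "z \<in> cyc d" and out: "\<And>y. y \<in> ?N \<Longrightarrow> y \<notin> cyc d \<Longrightarrow> y [^] p = \<one>"
    using core[OF N Np zN] by blast
  have dG: "d \<in> carrier G" using d subgroup.mem_carrier[OF N] by blast
  have cd: "cyc d \<subseteq> ?N" using cyc_least[OF N] d by blast
  have "c \<in> cyc d" using out c by blast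
  then obtain k where k: "c = d [^] (k::nat)" using cyc_nat[OF dG] by blast
  have dp: "d [^] p \<noteq> \<one>"
  proof
    assume "d [^] p = \<one>"
    then have "c [^] p = \<one>" using dG k by (metis nat_pow_one nat_pow_pow mult.commute)
    then show False using c by blast
  qed
  note inv = normalizer_root_centralizer[OF t N Np sub subset_refl d(1) dp]
  have "ord d dvd 2 ^ 2" using inv(2) dG p2 by (simp add: pow_eq_id)
  then obtain i where i: "ord d = 2 ^ i" "i \<le> 2" using divides_primepow_nat[of 2 "ord d" 2] two_is_prime_nat by blast
  have "\<not> ord d dvd 2" using dp dG p2 by (simp add: pow_eq_id)
  then have "i = 2" using i by (cases "i = 0 \<or> i = 1") auto
  then have cd4: "card (cyc d) = 4" using generate_pow_card[OF dG] i by simp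
  have td: "t \<notin> cyc d" using not_in_cyclic[OF t dG d(2)] .
  have inverts: "conj_by w d = inv d" if w: "w \<in> ?N - cyc d" for w
  proof -
    have wG: "w \<in> carrier G" using w subgroup.mem_carrier[OF N] by blast
    have "w \<otimes> d \<notin> cyc d" using mult_not_in_subgroup(1)[OF cyc_subgroup[OF dG] wG _ cyc_self] w by blast
    moreover have "w \<otimes> d \<in> ?N" using w d subgroup.m_closed[OF N] by blast
    ultimately show ?thesis using square_prod_inverts[OF wG dG] out w p2 by blast
  qed
  have dinv: "inv d \<noteq> d" using dp p2 dG by (metis numeral_2_eq_2 nat_pow_Suc nat_pow_0 l_one l_inv)
  have "card ?N = 2 * card (cyc d)"
  proof (rule card_two_cosets[OF cyc_subgroup[OF dG] N cd])
    show "t \<in> ?N - cyc d" using tN td by blast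
    fix w assume w: "w \<in> ?N - cyc d"
    have wG: "w \<in> carrier G" using w subgroup.mem_carrier[OF N] by blast
    have "t \<otimes> w \<in> centralizer d" using inverts_twice_commutes[OF t(1) wG dG] inverts w tN td by blast
    then have "conj_by (t \<otimes> w) d = d" using conj_by_fixes_iff[of "t \<otimes> w" d] t wG dG by (simp add: centralizer_def)
    moreover have "t \<otimes> w \<in> ?N" using tN w subgroup.m_closed[OF N] by blast
    ultimately show "t \<otimes> w \<in> cyc d" using inverts[of "t \<otimes> w"] dinv by auto
  qed
  then show 8: "card ?N = 8" using cd4 by simp
  have "card (centralizer t) < card ?N" using sub ne finite_sub[OF subgroup.subset[OF N]] by (metis psubsetI psubset_card_mono)
  moreover have "card (centralizer t) > 0" using card_subgroup_pos[OF sg] .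
  ultimately show "card (centralizer t) = 4" using four_dvd_root_centralizer[OF t] 8 by (auto elim!: dvdE)
  have "cyc d \<subseteq> centralizer d" using cyc_least subgroup_centralizer centralizer_self dG by blast
  then have "4 dvd card (centralizer d)"
    using card_subgroup_dvd[OF cyc_subgroup[OF dG] subgroup_centralizer[OF dG]] cd4 by simp
  moreover have "t \<in> normalizer G (centralizer d)"
  proof -
    have "conj_by t ` centralizer d = centralizer (inv d)" using centralizer_conj_by[OF t(1) dG] inv(1) by simp
    also have "\<dots> = centralizer d"
      using dG by (auto simp: centralizer_def) (metis inv_closed inv_solve_left inv_solve_right m_assoc m_closed inv_inv)+
    finally show ?thesis using t centralizer_memD(1) by (simp add: normalizer_eq subset_iff)
  qed
  moreover have "t \<notin> centralizer d" 
    using inv(1) dinv t dG conj_by_fixes_iff[of t d] by (auto simp: centralizer_def)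
  ultimately show "\<exists>a\<in>carrier G. a [^] p \<noteq> \<one> \<and> 4 dvd card (centralizer a) \<and> normalizer G (centralizer a) \<noteq> centralizer a"
    using dG dp by blast
qed

text \<open>
The weights of all classes add up to \<open>1 - density\<close>.
\<close>
definition density :: real where
  "density = card center / order G"

lemma density_pos: "density > 0"
  using Z_card_pos order_pos by (simp add: density_def)

lemma weight_dihedral_centralizer:
  assumes a: "a \<in> carrier G" "a [^] p \<noteq> \<one>" and ne: "normalizer G (centralizer a) \<noteq> centralizer a"
  obtains n :: nat where "n \<ge> 2" "card (centralizer a) = n * 2" "weight (centralizer a) = (1 - inverse (real n)) / 2"
    "2 * (real n)\<^sup>2 * density \<le> 1"
proof -
  have B: "centralizer a \<in> noncentral_centralizers" using a noncentral_of_pow by blast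
  obtain n where n: "card (centralizer a) = n * card center" "n \<ge> 2" using block_index[OF B] .
  have N: "card (normalizer G (centralizer a)) = 2 * card (centralizer a)" using card_normalizer_centralizer[OF a ne] .
  have "weight (centralizer a) = (1 - inverse (real n)) / 2" using weight_index[OF B N n(1)] by (simp add: inverse_eq_divide)
  moreover have "n * (2 * (n * 2)) \<le> order G" using normalizer_square_bound[OF a, of n] N n card_center by simp
  then have "real (n * (2 * (n * 2))) \<le> real (order G)" using of_nat_le_iff by blast
  then have "2 * (real n)\<^sup>2 * density \<le> 1"
    using order_pos by (simp add: density_def card_center field_simps power2_eq_square)
  ultimately show ?thesis using that n card_center by simp
qed

text \<open>
The first bound expresses that the normalizer of the block, of order \<open>4 n\<close>, is a proper subgroup.
\<close>
lemma weight_dihedral_bounds: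
  assumes "n \<ge> 2" "2 * (real n)\<^sup>2 * density \<le> 1"
  shows "density < inverse (real n) / 2" "inverse (real n) \<le> 1 / 2"
proof -
  have n: "real n \<ge> 2" using assms(1) by simp
  then show "inverse (real n) \<le> 1 / 2" by (simp add: field_simps)
  have "2 * real n * density < 2 * (real n)\<^sup>2 * density"
    using n density_pos by (simp add: power2_eq_square)
  then show "density < inverse (real n) / 2" using assms(2) n by (simp add: field_simps)
qed

lemma weight_root_centralizer:
  assumes t: "t \<in> carrier G" "t \<notin> center" "t [^] p = \<one>" and ne: "normalizer G (centralizer t) \<noteq> centralizer t"
  shows "weight (centralizer t) = 1 / 4"
proof -
  have B: "centralizer t \<in> noncentral_centralizers" using t by blast
  show ?thesis
    using weight_eq[OF B, of 2] root_centralizer_not_self_normalizing(1,2)[OF t ne] card_center by simp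
qed

lemma weight_cases:
  assumes B: "B \<in> noncentral_centralizers"
  obtains (self) "weight B \<ge> 1 / 2"
  | (root) t where "t \<in> carrier G" "t \<notin> center" "t [^] p = \<one>" "B = centralizer t" "normalizer G B \<noteq> B" "weight B = 1 / 4"
  | (dihedral) a n where "a \<in> carrier G" "a [^] p \<noteq> \<one>" "B = centralizer a" "normalizer G B \<noteq> B" "n \<ge> 2"
      "weight B = (1 - inverse (real n)) / 2" "2 * (real n)\<^sup>2 * density \<le> 1"
proof -
  obtain g where g: "g \<in> carrier G" "g \<notin> center" "B = centralizer g" using B by blast
  show ?thesis
  proof (cases "normalizer G B = B")
    case True
    then show ?thesis using self weight_self_normalizing[OF B] by blast
  next
    case ne: False
    show ?thesis
    proof (cases "g [^] p = \<one>")
      case True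
      then show ?thesis using root[of g] g ne weight_root_centralizer[of g] by blast
    next
      case False
      show ?thesis
        using weight_dihedral_centralizer[OF g(1) False] dihedral[OF g(1) False g(3) ne] ne g(3) by metis
    qed
  qed
qed

lemma weight_ge_quarter:
  assumes "B \<in> noncentral_centralizers" shows "weight B \<ge> 1 / 4"
  using assms
proof (cases rule: weight_cases)
  case (dihedral a n)
  then show ?thesis using weight_dihedral_bounds(2)[OF dihedral(5,7)] by simp
qed simp_all

lemma density_sum_le: "class_disjoint \<S> \<Longrightarrow> (\<Sum>B\<in>\<S>. weight B) \<le> 1 - density"
  using class_disjoint_sum_le by (simp add: density_def)

lemma density_extend:
  assumes "class_disjoint \<S>" "(\<Sum>B\<in>\<S>. weight B) \<noteq> 1 - density"
  obtains C where "C \<in> noncentral_centralizers" "C \<notin> \<S>" "class_disjoint (insert C \<S>)"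
    "weight C + (\<Sum>B\<in>\<S>. weight B) \<le> 1 - density"
proof -
  obtain C where C: "C \<in> noncentral_centralizers" "C \<notin> \<S>" "class_disjoint (insert C \<S>)"
    using class_disjoint_extend[OF assms(1)] assms(2) unfolding density_def by metis
  have "weight C + (\<Sum>B\<in>\<S>. weight B) \<le> 1 - density"
    using density_sum_le[OF C(3)] C(2) class_disjoint_finite[OF assms(1)] by simp
  then show ?thesis using that C by blast
qed

text \<open>
The two classes are separated by whether \<open>p\<close>-th powers vanish.
\<close>
lemma root_cyclic_class_disjoint:
  assumes t: "t \<in> carrier G" "t \<notin> center" "t [^] p = \<one>" and a: "a \<in> carrier G" "a [^] p \<noteq> \<one>"
  shows "centralizer t \<noteq> centralizer a" "class_disjoint {centralizer t, centralizer a}"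
proof -
  have pw: "conj_by g x [^] p = \<one> \<longleftrightarrow> x [^] p = \<one>" if "g \<in> carrier G" "x \<in> carrier G" for g x
    using that conj_by_pow[of g x p] conj_by_inv_left(1)[of g "x [^] p"] by (metis conj_by_one(1) inv_closed nat_pow_closed)
  have 1: "x [^] p = \<one>" if x: "x \<in> class_union (centralizer t)" for x
    using x pw centralizer_exponent[OF t] centralizer_memD(1) by (auto simp: class_union_def)
  have 2: "x [^] p \<noteq> \<one>" if x: "x \<in> class_union (centralizer a)" for x
  proof -
    obtain g y where g: "g \<in> carrier G" "y \<in> centralizer a" "x = conj_by g y" "x \<notin> center" using x by (auto simp: class_union_def)
    then have "y \<notin> center" using conj_by_center by metis
    then have "y [^] p \<noteq> \<one>" using centralizer_cyclic_self[OF a g(2)] by blast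
    then show ?thesis using pw[OF g(1)] centralizer_memD(1)[OF g(2)] g(3) by blast
  qed
  have disj: "class_union (centralizer t) \<inter> class_union (centralizer a) = {}" using 1 2 by blast
  have B: "centralizer t \<in> noncentral_centralizers" "centralizer a \<in> noncentral_centralizers"
    using t a noncentral_of_pow by blast+
  show "centralizer t \<noteq> centralizer a" using centralizer_exponent[OF t] a centralizer_self[OF a(1)] by blast
  show "class_disjoint {centralizer t, centralizer a}" using disj B by (auto simp: class_disjoint_def pairwise_insert)
qed

text \<open>
Otherwise there are a block of weight \<open>1/4\<close> and a cyclic block of even index \<open>m\<close>
over the center. Exactly one more class fits, and the equation leaves only its solution \<open>(2, 3,
4)\<close> with center of index \<open>24\<close>, the rotation group of the cube; this contradicts
\<open>normalizer_square_bound\<close>.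
\<close>
lemma roots_self_normalizing:
  assumes t: "t \<in> carrier G" "t \<notin> center" "t [^] p = \<one>"
  shows "normalizer G (centralizer t) = centralizer t"
proof (rule ccontr)
  assume ne: "normalizer G (centralizer t) \<noteq> centralizer t"
  obtain a where a: "a \<in> carrier G" "a [^] p \<noteq> \<one>" "4 dvd card (centralizer a)" "normalizer G (centralizer a) \<noteq> centralizer a"
    using root_centralizer_not_self_normalizing(3)[OF t ne] by blast
  obtain m where m: "m \<ge> 2" "card (centralizer a) = m * 2" "weight (centralizer a) = (1 - inverse (real m)) / 2" 
      "2 * (real m)\<^sup>2 * density \<le> 1"
    using weight_dihedral_centralizer[OF a(1,2,4)] .
  note mb = weight_dihedral_bounds[OF m(1,4)]
  have "4 dvd m * 2" using a(3) m(2) by simp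
  then have even: "even m" by presburger
  note ind = root_cyclic_class_disjoint[OF t a(1,2)]
  have s2: "(\<Sum>B\<in>{centralizer t, centralizer a}. weight B) = 3/4 - inverse (real m) / 2"
    using ind(1) weight_root_centralizer[OF t ne] m(3) by simp
  have s2ne: "(\<Sum>B\<in>{centralizer t, centralizer a}. weight B) \<noteq> 1 - density" using s2 mb density_pos by linarith
  obtain C where C: "C \<in> noncentral_centralizers" "C \<notin> {centralizer t, centralizer a}"
    "class_disjoint (insert C {centralizer t, centralizer a})" "weight C + (3/4 - inverse (real m) / 2) \<le> 1 - density"
    using density_extend[OF ind(2)] s2 s2ne by metis
  have s3: "(\<Sum>B\<in>insert C {centralizer t, centralizer a}. weight B) = weight C + (3/4 - inverse (real m) / 2)"
    using C(2) s2 by simp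
  \<comment> \<open>A fourth class would add a weight of at least \<open>1/4\<close>.\<close>
  have exact: "weight C + (3/4 - inverse (real m) / 2) = 1 - density"
  proof (rule ccontr)
    assume "\<not> ?thesis"
    then obtain D where D: "D \<in> noncentral_centralizers"
      "weight D + (weight C + (3/4 - inverse (real m) / 2)) \<le> 1 - density"
      using density_extend[OF C(3)] s3 by metis
    then show False using weight_ge_quarter[OF D(1)] weight_ge_quarter[OF C(1)] mb density_pos by linarith
  qed
  show False
    using C(1)
  proof (cases rule: weight_cases)
    case self
    then show ?thesis using exact mb density_pos by linarith
  next
    case (root s)
    then show ?thesis using exact mb density_pos by linarith
  next
    case (dihedral b n)
    note nb = weight_dihedral_bounds[OF dihedral(5,7)]
    have eq: "inverse (real m) / 2 + inverse (real n) / 2 = 1/4 + density"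
      using exact dihedral(6) by (simp add: field_simps)
    have "inverse (real m) < 1 / 2" using eq nb by linarith
    then have "m > 2" using m(1) by (cases "m = 2") auto
    \<comment> \<open>The parity of \<open>m\<close> is essential: the solution \<open>(2, 3, 5)\<close> of the rotation group of the icosahedron satisfies all the inequalities.\<close>
    then have m4: "m \<ge> 4" using even by presburger
    have "inverse (real n) < 1 / 2" using eq mb by linarith
    then have n3: "n \<ge> 3" using dihedral(5) by (cases "n = 2") auto
    have "inverse (real n) \<le> 1 / 3" using n3 by (simp add: field_simps)
    then have "inverse (real m) > 1 / 6" using eq density_pos by linarith
    then have "m < 6" using m4 by (simp add: field_simps)
    then have "m = 4" using m4 even by presburger
    then have "inverse (real n) > 1 / 4" using eq density_pos by simp
    then have "n < 4" using n3 by (simp add: field_simps)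
    then have "n = 3" using n3 by simp
    then have "density = 1 / 24" using eq \<open>m = 4\<close> by simp
    then show ?thesis using m(4) \<open>m = 4\<close> by simp
  qed
qed

text \<open>
The centralizer of a non-central involution has weight \<open>1 - 1/k\<close> with \<open>k\<close> even, and
exactly one more class fits, which must be that of a non-self-normalizing cyclic block. Then \<open>k =
2\<close> forces this block to be normal, and \<open>k \<ge> 4\<close> makes the two weights add up to at
least \<open>1\<close>.
\<close>
lemma even_contradiction: False
proof -
  obtain t where t: "t \<in> carrier G" "t \<notin> center" "t [^] p = \<one>" using noncentral_root_exists by blast
  have B: "centralizer t \<in> noncentral_centralizers" using t by blast
  note N = roots_self_normalizing[OF t]
  obtain k where k: "card (centralizer t) = k * card center" "k \<ge> 2" using block_index[OF B] .
  have wt: "weight (centralizer t) = 1 - inverse (real k)" using weight_index[OF B, of 1 k] N k by (simp add: inverse_eq_divide)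
  have "4 dvd k * 2" using four_dvd_root_centralizer[OF t] k card_center by simp
  then have even: "even k" by presburger
  have kb: "inverse (real k) \<le> 1 / 2" using k(2) by (simp add: field_simps)
  have ne: "weight (centralizer t) \<noteq> 1 - density"
  proof
    assume "weight (centralizer t) = 1 - density"
    then have "1 / real k = card center / order G" using wt by (simp add: density_def inverse_eq_divide)
    then have "real (card (centralizer t)) = order G" using k Z_card_pos order_pos by (simp add: field_simps)
    then have "card (centralizer t) = card (carrier G)" by (simp add: order_def)
    moreover have "centralizer t \<subseteq> carrier G" using centralizer_memD by blast
    ultimately have "centralizer t = carrier G" using fin card_subset_eq by blast
    then show False using noncentral_centralizer t by blast
  qed
  obtain C where C: "C \<in> noncentral_centralizers" "C \<notin> {centralizer t}"
    "class_disjoint (insert C {centralizer t})" "weight C + weight (centralizer t) \<le> 1 - density"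
    using density_extend[OF class_disjoint_single[OF B]] ne by auto
  have s2: "(\<Sum>B\<in>insert C {centralizer t}. weight B) = weight C + weight (centralizer t)" using C(2) by simp
  have exact: "weight C + weight (centralizer t) = 1 - density"
  proof (rule ccontr)
    assume "\<not> ?thesis"
    then obtain D where D: "D \<in> noncentral_centralizers"
      "weight D + (weight C + weight (centralizer t)) \<le> 1 - density"
      using density_extend[OF C(3)] s2 by metis
    then show False using weight_ge_quarter[OF D(1)] weight_ge_quarter[OF C(1)] wt kb density_pos by linarith
  qed
  show False
    using C(1)
  proof (cases rule: weight_cases)
    case self
    then show ?thesis using exact wt kb density_pos by linarith
  next
    case (root s)
    then show ?thesis using roots_self_normalizing[OF root(1,2,3)] by simp
  next
    case (dihedral b n)
    note nb = weight_dihedral_bounds[OF dihedral(5,7)]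
    have eq: "inverse (real k) + inverse (real n) / 2 = 1/2 + density"
      using exact wt dihedral(6) by (simp add: field_simps)
    then have "inverse (real k) < 1 / 2" using nb by linarith
    then have "k > 2" using k(2) by (cases "k = 2") auto
    then have "k \<ge> 4" using even by presburger
    then have "inverse (real k) \<le> 1 / 4" by (simp add: field_simps)
    then show ?thesis using eq nb density_pos by linarith
  qed
qed

end

section \<open>Odd primes\<close>

locale odd_cored_group = cored_group +
  assumes odd_p: "odd p"
begin

definition exponent_p :: "'a set \<Rightarrow> bool" where
  "exponent_p S \<longleftrightarrow> subgroup S G \<and> center \<subset> S \<and> (\<forall>x\<in>S. x [^] p = \<one>)"

definition max_exponent_p :: "'a set \<Rightarrow> bool" where
  "max_exponent_p P \<longleftrightarrow> exponent_p P \<and> (\<forall>Q. exponent_p Q \<longrightarrow> P \<subseteq> Q \<longrightarrow> Q = P)"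

lemma p_ge_3: "p \<ge> 3"
proof -
  have "p \<noteq> 2" using odd_p by auto
  then show ?thesis using prime_ge_2_nat[OF prime_p] by linarith
qed

lemma exponent_pD:
  assumes "exponent_p S"
  shows "subgroup S G" "S \<subseteq> carrier G" "center \<subset> S" "\<And>x. x \<in> S \<Longrightarrow> x [^] p = \<one>" "z \<in> S"
  using assms subgroup.subset z_in_center by (auto simp: exponent_p_def)

lemma exponent_p_card:
  assumes "exponent_p S" obtains n where "card S = p ^ n"
  using prime_power_exponent[OF exponent_pD(1)[OF assms] prime_p, of 1] exponent_pD(4)[OF assms] by auto

text \<open>
Let \<open>c^p \<noteq> \<one>\<close>. The core and \<open>D\<close> normalize each other, so the commutator
of \<open>c\<close> and \<open>t \<in> D\<close> lies in both and is therefore central. Oddness of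
\<open>p\<close> yields \<open>(t c)^p = c^p \<noteq> \<one>\<close>, although \<open>t c\<close> is outside
the core.
\<close>
lemma exponent_p_propagates:
  assumes D: "exponent_p D" and M: "subgroup M G" "M \<noteq> carrier G" "D \<subseteq> M" "M \<subseteq> normalizer G D" 
    and c: "c \<in> M"
  shows "c [^] p = \<one>"
proof (rule ccontr)
  assume cp: "c [^] p \<noteq> \<one>"
  note D = exponent_pD[OF D]
  obtain t where t: "t \<in> D" "t \<notin> center" using D(3) by blast
  have tG: "t \<in> carrier G" and cG: "c \<in> carrier G" using t c D(2) subgroup.mem_carrier[OF M(1)] by blast+
  have tM: "t \<in> M" using t M by blast
  obtain d where d: "d \<in> M" "z \<in> cyc d" and out: "\<And>y. y \<in> M \<Longrightarrow> y \<notin> cyc d \<Longrightarrow> y [^] p = \<one>"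
    using core[OF M(1,2)] M(3) D(5) by blast
  have dG: "d \<in> carrier G" using d subgroup.mem_carrier[OF M(1)] by blast
  note sd = cyc_subgroup[OF dG]
  have td: "t \<notin> cyc d" using root_in_cyclic[OF dG d(2)] t D(4) center_eq_cyc_z by blast
  have cd: "c \<in> cyc d" using out c cp by blast
  define s where "s = conj_by c t \<otimes> inv t"
  have s2: "s = c \<otimes> conj_by t (inv c)" using tG cG by (simp add: s_def conj_by_def m_assoc)
  have sG: "s \<in> carrier G" using tG cG by (simp add: s_def)
  have "conj_by t c [^] p \<noteq> \<one>"
    using cp tG cG conj_by_pow[of t c p] conj_by_inv_left(1)[of t "c [^] p"] by auto
  moreover have "conj_by t c \<in> M" using subgroup_conj_by_closed[OF M(1) tM c] .
  ultimately have "conj_by t c \<in> cyc d" using out by blast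
  then have "conj_by t (inv c) \<in> cyc d" using conj_by_inv[OF tG cG] subgroup.m_inv_closed[OF sd] by simp
  then have sd': "s \<in> cyc d" unfolding s2 using cd subgroup.m_closed[OF sd] by blast
  have "conj_by c t \<in> D" using normalizer_memD(2)[OF _ D(2), of c t] M(4) c t by blast
  then have "s \<in> D" unfolding s_def using t subgroup.m_closed[OF D(1)] subgroup.m_inv_closed[OF D(1)] by blast
  then have sp: "s [^] p = \<one>" using D(4) by blast
  then have "s \<in> center" using root_in_cyclic[OF dG d(2) sd'] center_eq_cyc_z by simp
  then have sc: "\<And>g. g \<in> carrier G \<Longrightarrow> s \<otimes> g = g \<otimes> s" using center_commute by metis
  have eq: "c \<otimes> t = s \<otimes> (t \<otimes> c)" using tG cG by (simp add: s_def conj_by_def word_simps)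
  have "(t \<otimes> c) [^] p = t [^] p \<otimes> c [^] p"
    using class_two_odd_power[OF tG cG sG eq sc odd_p sp] .
  then have "(t \<otimes> c) [^] p = c [^] p" using D(4)[OF t(1)] cG by simp
  moreover have "t \<otimes> c \<notin> cyc d"
    using mult_not_in_subgroup(1)[OF sd tG td cd] .
  moreover have "t \<otimes> c \<in> M" using tM c subgroup.m_closed[OF M(1)] by blast
  ultimately show False using out cp by metis
qed

lemma exponent_p_not_normal:
  assumes D: "exponent_p D" shows "normalizer G D \<noteq> carrier G"
proof
  assume N: "normalizer G D = carrier G"
  note sD = exponent_pD(1)[OF D]
  obtain n where "card D = p ^ n" using exponent_p_card[OF D] .
  then have sol: "solvable_seq G D" using solvable_prime_power[OF prime_p sD] by blast
  obtain c where c: "c \<in> carrier G" "c [^] p \<noteq> \<one>" using not_prime_power_exponent[of 1] by auto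
  note adj = not_adjoin_normal[OF sD sol N c(1)]
  have "adjoin D c \<subseteq> normalizer G D" using N adj(1) subgroup.subset by blast
  then show False using exponent_p_propagates[OF D adj(1,4,2) _ adj(3)] c by blast
qed

lemma exponent_p_normalizer:
  assumes D: "exponent_p D" shows "exponent_p (normalizer G D)"
proof -
  note sD = exponent_pD[OF D]
  have "center \<subset> normalizer G D" using sD(3) subset_normalizer[OF sD(1)] by blast
  then show ?thesis
    unfolding exponent_p_def
    using normalizer_subgroup[OF sD(1)] subset_normalizer[OF sD(1)] exponent_p_not_normal[OF D]
      exponent_p_propagates[OF D] by blast
qed

lemma max_exponent_p_exists:
  assumes "exponent_p D" obtains P where "max_exponent_p P" "D \<subseteq> P"
proof -
  let ?A = "{S. exponent_p S}"
  have "?A \<subseteq> Pow (carrier G)" using exponent_pD(2) by blast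
  then have "finite ?A" using fin finite_subset by blast
  then obtain P where "P \<in> ?A" "D \<subseteq> P" "\<And>Q. Q \<in> ?A \<Longrightarrow> P \<subseteq> Q \<Longrightarrow> P = Q"
    using finite_has_maximal2[of ?A D] assms by (metis mem_Collect_eq)
  then show ?thesis using that[of P] unfolding max_exponent_p_def by blast
qed

lemma max_exponent_p_self_normalizing: "max_exponent_p P \<Longrightarrow> normalizer G P = P"
  using exponent_p_normalizer subset_normalizer exponent_pD(1) unfolding max_exponent_p_def by blast

lemma exponent_p_centralizer:
  assumes "t \<in> carrier G" "t \<notin> center" "t [^] p = \<one>" shows "exponent_p (centralizer t)"
  unfolding exponent_p_def
  using subgroup_centralizer center_subset_centralizer centralizer_self centralizer_exponent[OF assms] assms by blast

text \<open>
Take a counterexample with largest intersection \<open>D\<close>. Normalizers grow in both groups, and the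
normalizer of \<open>D\<close> has exponent \<open>p\<close>, so it lies in a maximal such group that meets
each of the two in more than \<open>D\<close>. By the choice of \<open>D\<close> both are equal to it.
\<close>
lemma max_exponent_p_meet:
  assumes "max_exponent_p P" "max_exponent_p Q" "P \<noteq> Q"
  shows "P \<inter> Q \<subseteq> center"
proof -
  have "\<not> (max_exponent_p P \<and> max_exponent_p Q \<and> P \<noteq> Q \<and> \<not> P \<inter> Q \<subseteq> center)" for P Q
  \<comment> \<open>Descent on this number amounts to choosing a largest intersection.\<close>
  proof (induction "card (carrier G) - card (P \<inter> Q)" arbitrary: P Q rule: less_induct)
    case less
    show ?case
    proof
      assume *: "max_exponent_p P \<and> max_exponent_p Q \<and> P \<noteq> Q \<and> \<not> P \<inter> Q \<subseteq> center"
      let ?D = "P \<inter> Q"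
      have eP: "exponent_p P" and eQ: "exponent_p Q" using * by (auto simp: max_exponent_p_def)
      have sD: "subgroup ?D G" using subgroups_Inter_pair exponent_pD(1)[OF eP] exponent_pD(1)[OF eQ] by blast
      have eD: "exponent_p ?D"
        using sD exponent_pD(3,4)[OF eP] exponent_pD(3)[OF eQ] * unfolding exponent_p_def by blast
      obtain R where R: "max_exponent_p R" "normalizer G ?D \<subseteq> R"
        using max_exponent_p_exists[OF exponent_p_normalizer[OF eD]] .
      have "P' = R" if P': "max_exponent_p P'" "?D \<subset> P'" for P'
      proof (rule ccontr)
        assume ne: "P' \<noteq> R"
        have eP': "exponent_p P'" using P' by (simp add: max_exponent_p_def)
        obtain n where n: "card P' = p ^ n" using exponent_p_card[OF eP'] .
        obtain x where x: "x \<in> P' - ?D" "x \<in> normalizer G ?D"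
          using normalizers_grow[OF sD exponent_pD(1)[OF eP'] n prime_p P'(2)] .
        have "?D \<subseteq> R" using R subset_normalizer[OF sD] by blast
        then have sub: "?D \<subset> P' \<inter> R" using x R P'(2) by blast
        have PR: "P' \<inter> R \<subseteq> carrier G" using exponent_pD(2)[OF eP'] by blast
        then have "card ?D < card (P' \<inter> R)" using sub finite_sub psubset_card_mono by blast
        moreover have "card (P' \<inter> R) \<le> card (carrier G)" using PR fin card_mono by blast
        ultimately have "card (carrier G) - card (P' \<inter> R) < card (carrier G) - card ?D" by linarith
        moreover have "\<not> P' \<inter> R \<subseteq> center" using sub * by blast
        ultimately show False using less[of P' R] P'(1) R(1) ne by blast
      qed
      moreover have "?D \<subset> P" "?D \<subset> Q" using * eP eQ unfolding max_exponent_p_def by blast+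
      ultimately show False using * by metis
    qed
  qed
  then show ?thesis using assms by blast
qed

lemma exponent_p_conj: "exponent_p S \<Longrightarrow> g \<in> carrier G \<Longrightarrow> exponent_p (conj_by g ` S)"
proof -
  assume S: "exponent_p S" and g: "g \<in> carrier G"
  note S = exponent_pD[OF S]
  have "conj_by g ` center = center" using g conj_by_center by (force simp: image_def)
  then have "center \<subseteq> conj_by g ` S" using S(3) by blast
  moreover obtain x where x: "x \<in> S" "x \<notin> center" using S(3) by blast
  then have "conj_by g x \<notin> center" using conj_by_noncentral[OF g] S(2) by blast
  ultimately have "center \<subset> conj_by g ` S" using x by blast
  moreover have "conj_by g x [^] p = \<one>" if "x \<in> S" for x
    using that S(2,4) conj_by_pow[OF g, of x p] g by (auto simp: subset_iff)
  ultimately show "exponent_p (conj_by g ` S)"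
    unfolding exponent_p_def using subgroup_conj_by_image[OF g S(1)] by auto
qed

lemma max_exponent_p_conj:
  assumes P: "max_exponent_p P" and g: "g \<in> carrier G"
  shows "max_exponent_p (conj_by g ` P)"
proof -
  have eP: "exponent_p P" using P by (simp add: max_exponent_p_def)
  have "Q = conj_by g ` P" if Q: "exponent_p Q" "conj_by g ` P \<subseteq> Q" for Q
  proof -
    have "conj_by (inv g) ` conj_by g ` P \<subseteq> conj_by (inv g) ` Q" using Q by blast
    moreover have "conj_by (inv g) ` conj_by g ` P = P" using conj_by_image_inv[OF g exponent_pD(2)[OF eP] refl] .
    moreover have "exponent_p (conj_by (inv g) ` Q)" using exponent_p_conj Q g by simp
    ultimately have "conj_by (inv g) ` Q = P" using P unfolding max_exponent_p_def by metis
    then have "conj_by (inv (inv g)) ` P = Q"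
      using conj_by_image_inv[of "inv g" Q P] exponent_pD(2)[OF Q(1)] g by blast
    then show ?thesis using g by simp
  qed
  then show ?thesis using exponent_p_conj[OF eP g] unfolding max_exponent_p_def by blast
qed

definition blocks :: "'a set set" where
  "blocks = {centralizer a | a. a \<in> carrier G \<and> a [^] p \<noteq> \<one>} \<union> {P. max_exponent_p P}"

lemma centralizer_cyclic_eq:
  assumes a: "a \<in> carrier G" "a [^] p \<noteq> \<one>" and x: "x \<in> centralizer a" "x [^] p \<noteq> \<one>"
  shows "centralizer x = centralizer a"
proof
  have xG: "x \<in> carrier G" using x centralizer_memD by blast
  have ax: "a \<in> centralizer x" using centralizer_sym[OF a(1) x(1)] .
  show "centralizer x \<subseteq> centralizer a"
  proof
    fix y assume y: "y \<in> centralizer x"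
    then show "y \<in> centralizer a" using centralizer_cyclic_commute[OF xG x(2) y ax] centralizer_memD(1)[OF y] by (simp add: centralizer_def)
  qed
  show "centralizer a \<subseteq> centralizer x"
  proof
    fix y assume y: "y \<in> centralizer a"
    then show "y \<in> centralizer x" using centralizer_cyclic_commute[OF a y x(1)] centralizer_memD(1)[OF y] by (simp add: centralizer_def)
  qed
qed

lemma block_system_blocks: "block_system G center blocks"
proof (intro block_system.intro block_system_axioms.intro)
  show "finite_group G" by (rule finite_group_axioms)
  show "subgroup center G" by (rule center_subgroup)
next
  fix B assume B: "B \<in> blocks"
  then consider a where "a \<in> carrier G" "a [^] p \<noteq> \<one>" "B = centralizer a" | "max_exponent_p B"
    by (auto simp: blocks_def)
  then show "subgroup B G" 
    by cases (use subgroup_centralizer exponent_pD(1) max_exponent_p_def in auto)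
next
  fix B assume B: "B \<in> blocks"
  then consider a where "a \<in> carrier G" "a [^] p \<noteq> \<one>" "B = centralizer a" | "max_exponent_p B"
    by (auto simp: blocks_def)
  then show "center \<subset> B"
  proof cases
    case 1
    then show ?thesis using center_subset_centralizer[OF 1(1)] centralizer_self[OF 1(1)] noncentral_of_pow[OF 1(1,2)] by blast
  next
    case 2
    then show ?thesis using exponent_pD(3) unfolding max_exponent_p_def by blast
  qed
next
  fix B g assume B: "B \<in> blocks" and g: "g \<in> carrier G"
  then consider a where "a \<in> carrier G" "a [^] p \<noteq> \<one>" "B = centralizer a" | "max_exponent_p B"
    by (auto simp: blocks_def)
  then show "conj_by g ` B \<in> blocks"
  proof cases
    case 1
    have "conj_by g a [^] p \<noteq> \<one>" using 1 g conj_by_pow[of g a p] conj_by_inv_left(1)[of g "a [^] p"] by auto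
    moreover have "conj_by g ` B = centralizer (conj_by g a)" using 1 g centralizer_conj_by by blast
    ultimately show ?thesis using 1 g conj_by_closed unfolding blocks_def by blast
  next
    case 2
    then show ?thesis using max_exponent_p_conj[OF 2 g] unfolding blocks_def by blast
  qed
next
  fix B C assume B: "B \<in> blocks" and C: "C \<in> blocks" and ne: "B \<noteq> C"
  have mixed: "centralizer a \<inter> P \<subseteq> center" if "a \<in> carrier G" "a [^] p \<noteq> \<one>" "max_exponent_p P" for a P
    using centralizer_cyclic_self[OF that(1,2)] exponent_pD(4) that(3) unfolding max_exponent_p_def by blast
  have cc: "centralizer a \<inter> centralizer b \<subseteq> center" 
    if "a \<in> carrier G" "a [^] p \<noteq> \<one>" "b \<in> carrier G" "b [^] p \<noteq> \<one>" "centralizer a \<noteq> centralizer b" for a b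
  proof
    fix x assume x: "x \<in> centralizer a \<inter> centralizer b"
    show "x \<in> center"
    proof (rule ccontr)
      assume "x \<notin> center"
      then have "x [^] p \<noteq> \<one>" using centralizer_cyclic_self[OF that(1,2)] x by blast
      then have "centralizer x = centralizer a" "centralizer x = centralizer b"
        using centralizer_cyclic_eq[OF that(1,2)] centralizer_cyclic_eq[OF that(3,4)] x by blast+
      then show False using that(5) by simp
    qed
  qed
  show "B \<inter> C \<subseteq> center"
  proof (cases "max_exponent_p B")
    case mB: True
    show ?thesis
    proof (cases "max_exponent_p C")
      case True
      then show ?thesis using max_exponent_p_meet[OF mB True ne] by blast
    next
      case False
      then show ?thesis using C mixed mB unfolding blocks_def by blast
    qed
  next
    case False
    then obtain a where a: "a \<in> carrier G" "a [^] p \<noteq> \<one>" "B = centralizer a" using B unfolding blocks_def by blast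
    show ?thesis
    proof (cases "max_exponent_p C")
      case True
      then show ?thesis using mixed[OF a(1,2)] a(3) by blast
    next
      case False
      then obtain b where "b \<in> carrier G" "b [^] p \<noteq> \<one>" "C = centralizer b" using C unfolding blocks_def by blast
      then show ?thesis using cc[OF a(1,2)] a(3) ne by blast
    qed
  qed
next
  fix g assume g: "g \<in> carrier G - center"
  show "\<exists>B\<in>blocks. g \<in> B"
  proof (cases "g [^] p = \<one>")
    case True
    then have "exponent_p (centralizer g)" using exponent_p_centralizer g by blast
    then obtain P where "max_exponent_p P" "centralizer g \<subseteq> P" using max_exponent_p_exists by blast
    then show ?thesis using centralizer_self g unfolding blocks_def by blast
  next
    case False
    then show ?thesis using centralizer_self g unfolding blocks_def by blast
  qed
qed

end

sublocale odd_cored_group \<subseteq> block_system G center blocks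
  by (rule block_system_blocks)

context odd_cored_group
begin

lemma card_center_odd: "card center = p"
  using center_eq_cyc_z card_cyc_z by simp

text \<open>
If \<open>w^p \<noteq> \<one>\<close>, then \<open>w\<close> commutes with \<open>y\<close> up to a central
factor, because \<open>w^p\<close> is central; then \<open>(w y)^p = w^p \<noteq> \<one>\<close> although
\<open>w y\<close> normalizes the block from outside.
\<close>
lemma no_square_order:
  assumes a: "a \<in> carrier G" "a [^] p \<noteq> \<one>" and y: "y \<in> normalizer G (centralizer a)" "y \<notin> centralizer a"
    and w: "w \<in> centralizer a" "w [^] (p ^ 2) = \<one>"
  shows "w [^] p = \<one>"
proof (rule ccontr)
  assume wp: "w [^] p \<noteq> \<one>"
  have sg: "subgroup (centralizer a) G" using a subgroup_centralizer by blast
  have N: "subgroup (normalizer G (centralizer a)) G" using normalizer_subgroup[OF sg] .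
  have yG: "y \<in> carrier G" and wG: "w \<in> carrier G" using y w centralizer_memD subgroup.mem_carrier[OF N] by blast+
  have root: "x \<in> center" if "x \<in> centralizer a" "x [^] p = \<one>" for x
    using centralizer_cyclic_self[OF a that(1)] that(2) by blast
  have "(w [^] p) [^] p = \<one>" using w(2) wG by (simp add: nat_pow_pow power2_eq_square)
  then have wpc: "w [^] p \<in> center" using root subgroup_nat_pow_closed[OF sg w(1)] by blast
  have cjw: "conj_by y w \<in> centralizer a"
    using normalizer_memD(2)[OF y(1) subgroup.subset[OF sg] w(1)] .
  define s where "s = conj_by y w \<otimes> inv w"
  have sA: "s \<in> centralizer a" unfolding s_def using cjw w subgroup.m_closed[OF sg] subgroup.m_inv_closed[OF sg] by blast
  have sG: "s \<in> carrier G" using sA centralizer_memD by blast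
  have "s [^] p = conj_by y w [^] p \<otimes> inv w [^] p"
    unfolding s_def using centralizer_cyclic_commute[OF a cjw subgroup.m_inv_closed[OF sg w(1)]] yG wG
    by (intro pow_mult_commute) auto
  also have "\<dots> = w [^] p \<otimes> inv (w [^] p)"
    using conj_by_pow[OF yG wG, of p] conj_by_center[OF yG wpc] wG by (simp add: nat_pow_inv)
  finally have sp: "s [^] p = \<one>" using wG by simp
  then have "s \<in> center" using root sA by blast
  then have sc: "\<And>g. g \<in> carrier G \<Longrightarrow> s \<otimes> g = g \<otimes> s" using center_commute by metis
  have eq: "y \<otimes> w = s \<otimes> (w \<otimes> y)" using yG wG by (simp add: s_def conj_by_def word_simps)
  have "(w \<otimes> y) [^] p = w [^] p \<otimes> y [^] p"
    using class_two_odd_power[OF wG yG sG eq sc odd_p sp] .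
  also have "\<dots> = w [^] p" using normalizer_centralizer_cyclic[OF a y] wG by simp
  finally have "(w \<otimes> y) [^] p \<noteq> \<one>" using wp by simp
  moreover have "w \<otimes> y \<notin> centralizer a" using mult_not_in_subgroup(2)[OF sg yG y(2) w(1)] .
  moreover have "w \<otimes> y \<in> normalizer G (centralizer a)" 
    using w y subset_normalizer[OF sg] subgroup.m_closed[OF N] by blast
  ultimately show False using normalizer_centralizer_cyclic[OF a] by blast
qed

text \<open>
An element \<open>y\<close> outside the block has order \<open>p\<close>, so its powers \<open>y^i\<close>
with \<open>i < p\<close> lie in different cosets of the block.
\<close>
lemma card_normalizer_ge:
  assumes a: "a \<in> carrier G" "a [^] p \<noteq> \<one>" and y: "y \<in> normalizer G (centralizer a)" "y \<notin> centralizer a"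
  shows "p * card (centralizer a) \<le> card (normalizer G (centralizer a))"
proof -
  have sg: "subgroup (centralizer a) G" using a subgroup_centralizer by blast
  have N: "subgroup (normalizer G (centralizer a)) G" using normalizer_subgroup[OF sg] .
  have yG: "y \<in> carrier G" using y subgroup.mem_carrier[OF N] by blast
  have yp: "y [^] p = \<one>" using normalizer_centralizer_cyclic[OF a y] .
  let ?f = "\<lambda>(i :: nat, x). y [^] i \<otimes> x"
  have aux: "i = j" if "i \<le> j" "j < p" "x \<in> centralizer a" "w \<in> centralizer a" "y [^] i \<otimes> x = y [^] j \<otimes> w" for i j x w
  proof (rule ccontr)
    assume ne: "i \<noteq> j"
    have xw: "x \<in> carrier G" "w \<in> carrier G" using that centralizer_memD by blast+
    have "y [^] j = y [^] i \<otimes> y [^] (j - i)" using yG that by (simp add: nat_pow_mult)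
    then have "y [^] i \<otimes> x = y [^] i \<otimes> (y [^] (j - i) \<otimes> w)" using that xw yG by (simp add: m_assoc)
    then have "x = y [^] (j - i) \<otimes> w" using xw yG by simp
    then have "y [^] (j - i) = x \<otimes> inv w" using xw yG by (simp add: m_assoc)
    then have yd: "y [^] (j - i) \<in> centralizer a" using that subgroup.m_closed[OF sg] subgroup.m_inv_closed[OF sg] by metis
    have "\<not> p dvd j - i" using ne that by (auto dest: dvd_imp_le)
    then have "coprime (j - i) p" using prime_imp_coprime[OF prime_p] by (metis coprime_commute)
    then obtain u where "[(j - i) * u = 1] (mod p)" using cong_solve_coprime_nat[of "j - i" p] by auto
    moreover have "1 mod p = 1" using prime_gt_1_nat[OF prime_p] by simp
    ultimately have u: "((j - i) * u) mod p = 1" by (simp add: cong_def)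
    have "(j - i) * u = p * ((j - i) * u div p) + 1" using u by (metis mult_div_mod_eq)
    then have "(y [^] (j - i)) [^] u = y [^] (p * ((j - i) * u div p) + 1)" using yG by (simp add: nat_pow_pow)
    also have "\<dots> = (y [^] p) [^] ((j - i) * u div p) \<otimes> y [^] (1::nat)"
      by (simp only: nat_pow_mult[OF yG] nat_pow_pow[OF yG])
    also have "\<dots> = y" using yp yG by simp
    finally have "y \<in> centralizer a" using subgroup_nat_pow_closed[OF sg yd, of u] by simp
    then show False using y by blast
  qed
  have inj: "inj_on ?f ({..<p} \<times> centralizer a)"
  proof (rule inj_onI, clarsimp)
    fix i x j w assume *: "i < p" "x \<in> centralizer a" "j < p" "w \<in> centralizer a" "y [^] i \<otimes> x = y [^] j \<otimes> w"
    have "i = j" using aux[of i j x w] aux[of j i w x] * by (metis nat_le_linear)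
    moreover have "x = w" using * \<open>i = j\<close> yG centralizer_memD(1) by (metis l_cancel nat_pow_closed)
    ultimately show "i = j \<and> x = w" by blast
  qed
  have "?f ` ({..<p} \<times> centralizer a) \<subseteq> normalizer G (centralizer a)"
    using subgroup_nat_pow_closed[OF N y(1)] subset_normalizer[OF sg] subgroup.m_closed[OF N] by auto
  then have "card ({..<p} \<times> centralizer a) \<le> card (normalizer G (centralizer a))"
    using card_inj_on_le[OF inj] finite_sub[OF subgroup.subset[OF N]] by blast
  then show ?thesis by (simp add: card_cartesian_product)
qed

text \<open>
The order of the cyclic centralizer is \<open>p m\<close> with \<open>m \<noteq> 1\<close>, and
\<open>p\<close> does not divide \<open>m\<close> by \<open>no_square_order\<close>.
\<close>
lemma other_prime_element:
  assumes a: "a \<in> carrier G" "a [^] p \<noteq> \<one>" and y: "y \<in> normalizer G (centralizer a)" "y \<notin> centralizer a"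
  obtains k q where "k \<in> centralizer a" "k [^] p \<noteq> \<one>" "prime q" "ord k = q"
proof -
  obtain c where c: "c \<in> carrier G" "centralizer a = cyc c" using centralizer_cyclic[OF a] .
  have r0: "ord c > 0" using ord_ge_1[OF fin c(1)] by simp
  have "cyc z \<subseteq> cyc c" using cyc_least[OF cyc_subgroup[OF c(1)]] z_in_centralizer[OF a(1)] c(2) by simp
  then have "p dvd ord c"
    using card_subgroup_dvd[OF cyc_subgroup[OF z_closed] cyc_subgroup[OF c(1)]] card_cyc_z generate_pow_card[OF c(1)] by simp
  then obtain m where m: "ord c = p * m" by auto
  have "m \<noteq> 1"
  proof
    assume "m = 1"
    then have "c [^] p = \<one>" using m pow_eq_id[OF c(1)] by simp
    moreover obtain i where "a = c [^] (i::nat)" using cyc_nat[OF c(1)] centralizer_self[OF a(1)] c(2) by auto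
    ultimately have "a [^] p = \<one>" using c(1) by (metis nat_pow_one nat_pow_pow mult.commute)
    then show False using a by blast
  qed
  then obtain q where q: "prime q" "q dvd m" using prime_factor_nat by blast
  then obtain l where l: "m = q * l" by auto
  have ordp: "ord (c [^] d) = ord c div d" if "d dvd ord c" "d > 0" for d
    using ord_pow[OF c(1) that(1)] that(2) by auto
  have l0: "l > 0" "p > 0" "q > 0" using r0 m l by auto
  have mem: "c [^] (d::nat) \<in> centralizer a" for d using subgroup_nat_pow_closed[OF cyc_subgroup[OF c(1)] cyc_self] c(2) by simp
  show ?thesis
  proof (cases "q = p")
    case True
    have w: "ord (c [^] l) = p ^ 2" using ordp[of l] m l True l0 by (simp add: power2_eq_square)
    then have "(c [^] l) [^] (p ^ 2) = \<one>" using pow_eq_id[of "c [^] l"] c(1) by simp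
    then have "(c [^] l) [^] p = \<one>" using no_square_order[OF a y mem] by blast
    then have "p ^ 2 dvd p" using w pow_eq_id[of "c [^] l" p] c(1) by simp
    then have "p * p \<le> p" using l0 by (auto dest: dvd_imp_le simp: power2_eq_square)
    then show ?thesis using p_ge_3 by simp
  next
    case False
    have k: "ord (c [^] (p * l)) = q" using ordp[of "p * l"] m l l0 by simp
    have "\<not> q dvd p" using False q prime_p primes_dvd_imp_eq by blast
    then have "(c [^] (p * l)) [^] p \<noteq> \<one>" using k pow_eq_id[of "c [^] (p * l)" p] c(1) by simp
    then show ?thesis using that[OF mem _ q(1) k] by blast
  qed
qed

text \<open>
The normalizer acts on the subgroup generated by an element \<open>k\<close> of prime order \<open>q \<noteq>
p\<close> through exponents \<open>i\<close> with \<open>i^p = 1\<close> modulo \<open>q\<close>, of which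
there are at most \<open>p\<close>. Elements with the same exponent differ by one that centralizes
\<open>k\<close>, hence lies in the block.
\<close>
lemma card_normalizer_le:
  assumes a: "a \<in> carrier G" "a [^] p \<noteq> \<one>" and y: "y \<in> normalizer G (centralizer a)" "y \<notin> centralizer a"
  shows "card (normalizer G (centralizer a)) \<le> p * card (centralizer a)"
proof -
  let ?N = "normalizer G (centralizer a)"
  have sg: "subgroup (centralizer a) G" using a subgroup_centralizer by blast
  have N: "subgroup ?N G" using normalizer_subgroup[OF sg] .
  obtain k q where k: "k \<in> centralizer a" "k [^] p \<noteq> \<one>" and q: "prime q" "ord k = q"
    using other_prime_element[OF a y] .
  have kG: "k \<in> carrier G" using k centralizer_memD by blast
  obtain c where c: "c \<in> carrier G" "centralizer a = cyc c" using centralizer_cyclic[OF a] .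
  have kq: "k [^] q = \<one>" using q(2) pow_eq_id[OF kG, of q] by simp
  have k1: "k \<noteq> \<one>" using k by auto
  have powk: "k [^] i = k [^] j \<longleftrightarrow> [i = j] (mod q)" for i j :: nat
  proof
    assume eq: "k [^] i = k [^] j"
    have "int q dvd int j - int i" using int_pow_eq[OF kG, of "int i" "int j"] eq q by (simp add: int_pow_int)
    then show "[i = j] (mod q)" by (metis cong_iff_dvd_diff cong_int_iff cong_sym)
  next
    assume "[i = j] (mod q)"
    then show "k [^] i = k [^] j" using pow_mod_ord[OF kG] q by (metis cong_def)
  qed
  have "\<exists>i. i < q \<and> conj_by w k = k [^] (i::nat)" if w: "w \<in> ?N" for w
  proof -
    have wG: "w \<in> carrier G" using w subgroup.mem_carrier[OF N] by blast
    have "conj_by w k \<in> cyc c" using normalizer_memD(2)[OF w subgroup.subset[OF sg] k(1)] c by simp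
    moreover have "conj_by w k [^] q = \<one>" using conj_by_pow[OF wG kG, of q] kq wG by simp
    ultimately show ?thesis using cyclic_prime_roots[OF c(1) q(1), of k "conj_by w k"] k k1 kq c(2) by metis
  qed
  then obtain f where f: "\<And>w. w \<in> ?N \<Longrightarrow> f w < q \<and> conj_by w k = k [^] (f w :: nat)" by metis
  let ?R = "{x \<in> {..<q}. [x ^ p = 1] (mod q)}"
  have fR: "f w \<in> ?R" if w: "w \<in> ?N" for w
  proof -
    have wG: "w \<in> carrier G" using w subgroup.mem_carrier[OF N] by blast
    have it: "conj_by (w [^] n) k = k [^] (f w ^ n)" for n :: nat
    proof (induction n)
      case (Suc n)
      have "conj_by (w [^] Suc n) k = conj_by (w [^] n) (conj_by w k)" using wG kG by (simp add: conj_by_conj_by)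
      also have "\<dots> = conj_by (w [^] n) k [^] f w" using f[OF w] wG kG by (simp add: conj_by_pow)
      also have "\<dots> = k [^] (f w ^ Suc n)" unfolding Suc.IH using kG by (simp add: nat_pow_pow mult.commute)
      finally show ?case .
    qed (use kG in simp)
    have "conj_by (w [^] p) k = k"
    proof (cases "w \<in> centralizer a")
      case True
      then have "w \<otimes> k = k \<otimes> w" using centralizer_cyclic_commute[OF a True k(1)] by blast
      then have "w [^] p \<otimes> k = k \<otimes> w [^] p" using group_commutes_pow wG kG by metis
      then show ?thesis using conj_by_fixes_iff wG kG by simp
    next
      case False
      then show ?thesis using normalizer_centralizer_cyclic[OF a w] kG by simp
    qed
    then have "k [^] (f w ^ p) = k [^] (1::nat)" using it[of p] kG by simp
    then show ?thesis using powk[of "f w ^ p" 1] f[OF w] by simp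
  qed
  have fiber: "card {w \<in> ?N. f w = i} \<le> card (centralizer a)" for i
  proof (cases "{w \<in> ?N. f w = i} = {}")
    case False
    then obtain v where v: "v \<in> ?N" "f v = i" by blast
    have vG: "v \<in> carrier G" using v subgroup.mem_carrier[OF N] by blast
    have "{w \<in> ?N. f w = i} \<subseteq> (\<lambda>x. v \<otimes> x) ` centralizer a"
    proof clarify
      fix w assume w: "w \<in> ?N" "i = f w"
      have wG: "w \<in> carrier G" using w subgroup.mem_carrier[OF N] by blast
      have "conj_by w k = conj_by v k" using f[OF w(1)] f[OF v(1)] w v by simp
      then have "conj_by (inv v \<otimes> w) k = k" using vG wG kG by (simp add: conj_by_conj_by[symmetric])
      then have "inv v \<otimes> w \<in> centralizer k" using conj_by_fixes_iff[of "inv v \<otimes> w" k] vG wG kG by (simp add: centralizer_def)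
      then have "inv v \<otimes> w \<in> centralizer a" using centralizer_cyclic_eq[OF a k] by simp
      moreover have "w = v \<otimes> (inv v \<otimes> w)" using vG wG by (simp add: inv_cancel_left)
      ultimately show "w \<in> (\<lambda>x. v \<otimes> x) ` centralizer a" by blast
    qed
    moreover have finA: "finite (centralizer a)" using finite_sub subgroup.subset[OF sg] by blast
    ultimately have "card {w \<in> ?N. f w = i} \<le> card ((\<lambda>x. v \<otimes> x) ` centralizer a)" by (simp add: card_mono)
    also have "\<dots> \<le> card (centralizer a)" using finA card_image_le by blast
    finally show ?thesis .
  next
    case True
    then show ?thesis by (metis card.empty le0)
  qed
  have "?N = (\<Union>i\<in>?R. {w \<in> ?N. f w = i})" using fR by blast
  then have "card ?N \<le> (\<Sum>i\<in>?R. card {w \<in> ?N. f w = i})"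
    using card_UN_le[of ?R "\<lambda>i. {w \<in> ?N. f w = i}"] by simp
  also have "\<dots> \<le> card ?R * card (centralizer a)" using sum_bounded_above[of ?R] fiber by (metis (lifting) of_nat_id)
  also have "\<dots> \<le> p * card (centralizer a)"
    using roots_mod_prime_bound[OF q(1), of p 1] prime_gt_0_nat[OF prime_p] by (intro mult_le_mono1) simp
  finally show ?thesis .
qed

lemma card_normalizer_centralizer_odd:
  assumes a: "a \<in> carrier G" "a [^] p \<noteq> \<one>" and ne: "normalizer G (centralizer a) \<noteq> centralizer a"
  shows "card (normalizer G (centralizer a)) = p * card (centralizer a)"
proof -
  have "centralizer a \<subseteq> normalizer G (centralizer a)" using subset_normalizer subgroup_centralizer a by blast
  then obtain y where "y \<in> normalizer G (centralizer a)" "y \<notin> centralizer a" using ne by blast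
  then show ?thesis using card_normalizer_ge[OF a] card_normalizer_le[OF a] by (meson le_antisym)
qed

lemma weight_max_exponent_p:
  assumes P: "max_exponent_p P"
  obtains k :: nat where "card P = k * p" "p dvd k" "k > 0" "weight P = 1 - inverse (real k)"
proof -
  have eP: "exponent_p P" using P by (simp add: max_exponent_p_def)
  have B: "P \<in> blocks" using P by (simp add: blocks_def)
  obtain n where n: "card P = p ^ n" using exponent_p_card[OF eP] .
  obtain k where k: "card P = k * card center" "k \<ge> 2" using block_index[OF B] .
  have "p ^ n = k * p" using n k card_center_odd by simp
  then obtain i where i: "n = Suc i" using k(2) prime_gt_1_nat[OF prime_p] by (cases n) auto
  then have "k = p ^ i" using \<open>p ^ n = k * p\<close> prime_gt_0_nat[OF prime_p] by simp
  then have "p dvd k" using k(2) by (cases i) auto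
  moreover have "weight P = 1 - inverse (real k)"
    using weight_index[OF B, of 1 k] max_exponent_p_self_normalizing[OF P] k by (simp add: inverse_eq_divide)
  ultimately show ?thesis using that k card_center_odd by simp
qed

lemma weight_cases:
  assumes B: "B \<in> blocks"
  obtains (self) "weight B \<ge> 1 / 2"
  | (frobenius) n where "n \<ge> 2" "weight B = (1 - inverse (real n)) * inverse p" "card (normalizer G B) = p * (n * p)"
      "normalizer G B \<noteq> carrier G"
proof (cases "normalizer G B = B")
  case True
  then show ?thesis using self weight_self_normalizing[OF B] by blast
next
  case False
  then have "\<not> max_exponent_p B" using max_exponent_p_self_normalizing by blast
  then obtain a where a: "a \<in> carrier G" "a [^] p \<noteq> \<one>" "B = centralizer a" using B by (auto simp: blocks_def)
  have N: "card (normalizer G B) = p * card B" using card_normalizer_centralizer_odd[OF a(1,2)] False a(3) by simp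
  obtain n where n: "card B = n * card center" "n \<ge> 2" using block_index[OF B] .
  have "weight B = (1 - inverse (real n)) * inverse p"
    using weight_index[OF B N n(1)] by (simp add: divide_inverse)
  then show ?thesis
    using frobenius[OF n(2)] N n(1) card_center_odd centralizer_cyclic_not_normal[OF a(1,2)] a(3) by simp
qed

lemma weight_ge: "B \<in> blocks \<Longrightarrow> weight B \<ge> inverse p / 2"
proof -
  assume B: "B \<in> blocks"
  have p3: "real p \<ge> 3" using p_ge_3 by simp
  show ?thesis using B
  proof (cases rule: weight_cases)
    case self
    moreover have "inverse (real p) \<le> 1" using p3 by (simp add: field_simps)
    ultimately show ?thesis by linarith
  next
    case (frobenius n)
    have "1 - inverse (real n) \<ge> 1 / 2" using frobenius(1) by (simp add: field_simps)
    then have "(1 - inverse (real n)) * inverse p \<ge> (1 / 2) * inverse p" by (rule mult_right_mono) simp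
    then show ?thesis using frobenius(2) by simp
  qed
qed

text \<open>
A maximal subgroup of exponent \<open>p\<close> has weight \<open>1 - 1/k\<close> with \<open>k\<close> a
multiple of \<open>p\<close>, and every class has weight at least \<open>1/(2 p)\<close>. So a second class
forces \<open>k = p\<close>, there is no third one, and the equation says that the second block is normal.
\<close>
lemma odd_contradiction: False
proof -
  obtain t where t: "t \<in> carrier G" "t \<notin> center" "t [^] p = \<one>" using noncentral_root_exists by blast
  obtain P where P: "max_exponent_p P" using max_exponent_p_exists[OF exponent_p_centralizer[OF t]] by blast
  have B: "P \<in> blocks" using P by (simp add: blocks_def)
  obtain k :: nat where k: "card P = k * p" "p dvd k" "k > 0" "weight P = 1 - inverse (real k)"
    using weight_max_exponent_p[OF P] .
  define \<gamma> where "\<gamma> = real p / order G"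
  have p3: "real p \<ge> 3" using p_ge_3 by simp
  then have \<gamma>: "\<gamma> > 0" using order_pos by (simp add: \<gamma>_def)
  have "k \<ge> p" using k by (simp add: dvd_imp_le)
  then have "inverse (real k) \<le> inverse (real p)" using p3 by (simp add: le_imp_inverse_le)
  moreover have ip: "inverse (real p) \<le> 1 / 3" using p3 by (simp add: field_simps)
  ultimately have ik: "inverse (real k) \<le> 1 / 3" by linarith
  have "P \<noteq> carrier G"
    using P not_prime_power_exponent[of 1] exponent_pD(4)[of P] by (auto simp: max_exponent_p_def)
  then have "card P \<noteq> order G"
    using block_carrier[OF B] fin card_subset_eq unfolding order_def by blast
  have ne: "weight P \<noteq> 1 - \<gamma>"
  proof
    assume "weight P = 1 - \<gamma>"
    then have "inverse (real k) = real p / order G" using k(4) by (simp add: \<gamma>_def)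
    then have "real (order G) = real k * real p" using k(3) order_pos by (simp add: field_simps)
    then show False using \<open>card P \<noteq> order G\<close> k(1) by (metis of_nat_eq_iff of_nat_mult)
  qed
  obtain C where C: "C \<in> blocks" "C \<notin> {P}" "class_disjoint (insert C {P})"
    using class_disjoint_extend[OF class_disjoint_single[OF B]] ne unfolding \<gamma>_def card_center_odd by (metis (lifting) sum.insert sum.empty finite.emptyI empty_iff add.right_neutral)
  have s2: "(\<Sum>B\<in>insert C {P}. weight B) = weight C + weight P" using C(2) by simp
  have le2: "weight C + weight P \<le> 1 - \<gamma>"
    using class_disjoint_sum_le[OF C(3)] s2 unfolding \<gamma>_def card_center_odd by simp
  show False using C(1)
  proof (cases rule: weight_cases)
    case self
    then show ?thesis using le2 k(4) ik \<gamma> by linarith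
  next
    case (frobenius n)
    have "inverse p / 2 < inverse (real k)" using weight_ge[OF C(1)] le2 k(4) \<gamma> by linarith
    then have "real k < 2 * real p" using k(3) p3 by (simp add: field_simps)
    then have "k < 2 * p" by linarith
    moreover obtain i where "k = p * i" using k(2) by auto
    ultimately have kp: "k = p" using k(3) by (cases "i = 1") auto
    have exact: "weight C + weight P = 1 - \<gamma>"
    proof (rule ccontr)
      assume "\<not> ?thesis"
      then obtain D where D: "D \<in> blocks" "D \<notin> insert C {P}" "class_disjoint (insert D (insert C {P}))"
        using class_disjoint_extend[OF C(3)] s2 unfolding \<gamma>_def card_center_odd by metis
      have "weight D + (weight C + weight P) < 1"
        using class_disjoint_sum_less[OF D(3)] D(2) s2 by simp
      then show False using weight_ge[OF C(1)] weight_ge[OF D(1)] k(4)[unfolded kp] by linarith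
    qed
    have "inverse (real n) * inverse (real p) = \<gamma>"
      using exact k(4) kp frobenius(2) by (simp add: algebra_simps)
    then have "real (order G) = real p * (real n * real p)"
      using order_pos p3 frobenius(1) by (simp add: \<gamma>_def field_simps)
    then have "card (normalizer G C) = card (carrier G)"
      unfolding frobenius(3) order_def by (metis of_nat_eq_iff of_nat_mult)
    moreover have "normalizer G C \<subseteq> carrier G"
      using normalizer_subgroup[OF block_subgroup[OF C(1)]] subgroup.subset by blast
    ultimately show ?thesis using frobenius(4) fin card_subset_eq by blast
  qed
qed

end

section \<open>From partitions to cyclic cores\<close>

context finite_group
begin

lemma cyclic_subgroup_iff:
  assumes H: "subgroup H G"
  shows "cyclic_group (G\<lparr>carrier := H\<rparr>) \<longleftrightarrow> (\<exists>c\<in>H. H = cyc c)"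
proof -
  interpret K: group "G\<lparr>carrier := H\<rparr>" using H by (rule subgroup_imp_group)
  have "range (\<lambda>n::int. c [^]\<^bsub>G\<lparr>carrier := H\<rparr>\<^esub> n) = cyc c" if "c \<in> H" for c
    using K.generate_pow[of c] generate_consistent[of "{c}" H] H that by auto
  then show ?thesis unfolding K.cyclic_group by auto
qed

lemma partition_component:
  assumes H: "subgroup H G" and P: "nontrivial_partition (G\<lparr>carrier := H\<rparr>) P" and K: "K \<in> P"
  shows "subgroup K G" "K \<subseteq> H" "K \<noteq> {\<one>}"
proof -
  have "subgroup K (G\<lparr>carrier := H\<rparr>)" "K \<noteq> {\<one>}" using P K by (auto simp: nontrivial_partition_def)
  then show "subgroup K G" "K \<subseteq> H" "K \<noteq> {\<one>}" using incl_subgroup[OF H] subgroup.subset by fastforce+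
qed

lemma partition_component_exists:
  assumes "nontrivial_partition (G\<lparr>carrier := H\<rparr>) P" "y \<in> H" "y \<noteq> \<one>"
  obtains K where "K \<in> P" "y \<in> K"
  using assms unfolding nontrivial_partition_def by auto

lemma partition_component_unique:
  assumes H: "subgroup H G" and P: "nontrivial_partition (G\<lparr>carrier := H\<rparr>) P"
    and K: "K \<in> P" "L \<in> P" "y \<in> K" "y \<in> L" "y \<noteq> \<one>"
  shows "K = L"
proof -
  have "y \<in> H" using partition_component(2)[OF H P K(1)] K(3) by blast
  then show ?thesis using P K unfolding nontrivial_partition_def by auto
qed

lemma partition_component_proper:
  assumes H: "subgroup H G" and P: "nontrivial_partition (G\<lparr>carrier := H\<rparr>) P" and K: "K \<in> P"
  shows "K \<noteq> H"
proof
  assume KH: "K = H"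
  have "L = K" if L: "L \<in> P" for L
  proof -
    have "\<one> \<in> L" using subgroup.one_closed[OF partition_component(1)[OF H P L]] .
    then obtain y where "y \<in> L" "y \<noteq> \<one>" using partition_component(3)[OF H P L] by blast
    then show ?thesis using partition_component_unique[OF H P L K] partition_component(2)[OF H P L] KH by blast
  qed
  then have "P \<subseteq> {K}" by blast
  then have "card P \<le> 1" using card_mono[of "{K}" P] by simp
  then show False using P by (simp add: nontrivial_partition_def)
qed

text \<open>
A cyclic subgroup lies in one component, namely that of any of its non-identity elements.
\<close>
lemma partition_component_cyclic:
  assumes H: "subgroup H G" and P: "nontrivial_partition (G\<lparr>carrier := H\<rparr>) P" and K: "K \<in> P"
    and y: "y \<in> H" and w: "w \<in> cyc y" "w \<in> K" "w \<noteq> \<one>"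
  shows "y \<in> K"
proof (cases "y = \<one>")
  case True
  then show ?thesis using subgroup.one_closed[OF partition_component(1)[OF H P K]] by simp
next
  case False
  obtain L where L: "L \<in> P" "y \<in> L" using partition_component_exists[OF P y False] .
  have "w \<in> L" using cyc_least[OF partition_component(1)[OF H P L(1)] L(2)] w by blast
  then show ?thesis using partition_component_unique[OF H P L(1) K _ w(2,3)] L by blast
qed

definition maximal_cyclic :: "'a \<Rightarrow> bool" where
  "maximal_cyclic a \<longleftrightarrow> a \<in> carrier G \<and> (\<forall>b\<in>carrier G. cyc a \<subseteq> cyc b \<longrightarrow> cyc b = cyc a)"

lemma maximal_cyclic_exists:
  assumes "x \<in> carrier G" obtains a where "maximal_cyclic a" "x \<in> cyc a"
proof -
  let ?A = "cyc ` carrier G"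
  have "finite ?A" "cyc x \<in> ?A" using fin assms by auto
  from finite_has_maximal2[OF this] obtain a where a: "a \<in> carrier G" "cyc x \<subseteq> cyc a"
    and max: "\<forall>m\<in>?A. cyc a \<subseteq> m \<longrightarrow> cyc a = m" by auto
  have "maximal_cyclic a" unfolding maximal_cyclic_def using a(1) max by auto
  moreover have "x \<in> cyc a" using a(2) cyc_self[of x] by (rule subsetD)
  ultimately show ?thesis by (rule that)
qed

text \<open>
The maximal cyclic subgroups cover the group, and there are at least two of them unless the group is cyclic.
\<close>
lemma maximal_cyclic_partition:
  assumes nc: "\<not> cyclic_group G"
    and disj: "\<And>a b. maximal_cyclic a \<Longrightarrow> maximal_cyclic b \<Longrightarrow> cyc a \<noteq> cyc b \<Longrightarrow> cyc a \<inter> cyc b \<subseteq> {\<one>}"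
  shows "admits_nontrivial_partition G"
proof -
  have noncyc: "carrier G \<noteq> cyc a" if "a \<in> carrier G" for a
    using nc cyclic_subgroup_iff[OF subgroup_self] that by auto
  define P where "P = {cyc a | a. maximal_cyclic a}"
  have one: "cyc a \<noteq> {\<one>}" if "maximal_cyclic a" for a
  proof
    assume a1: "cyc a = {\<one>}"
    have aG: "a \<in> carrier G" using that by (simp add: maximal_cyclic_def)
    have "b = \<one>" if b: "b \<in> carrier G" for b
    proof -
      have "cyc a \<subseteq> cyc b" using a1 subgroup.one_closed[OF cyc_subgroup[OF b]] by simp
      then have "cyc b = {\<one>}" using a1 \<open>maximal_cyclic a\<close> b by (simp add: maximal_cyclic_def)
      then show ?thesis using cyc_self by blast
    qed
    then show False using noncyc[OF one_closed] generate_one by auto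
  qed
  have "finite P"
  proof (rule finite_subset)
    show "P \<subseteq> cyc ` carrier G" by (auto simp: P_def maximal_cyclic_def)
  qed (use fin in simp)
  moreover have "\<not> card P \<le> 1"
  proof
    assume "card P \<le> 1"
    obtain a where a: "maximal_cyclic a" using maximal_cyclic_exists[OF one_closed] by blast
    then have "P = {cyc a}" using \<open>card P \<le> 1\<close> \<open>finite P\<close>
      by (metis (mono_tags, lifting) One_nat_def P_def card_le_Suc0_iff_eq mem_Collect_eq singleton_iff subsetI subset_antisym)
    have "x \<in> cyc a" if x: "x \<in> carrier G" for x
    proof -
      obtain b where b: "maximal_cyclic b" "x \<in> cyc b" using maximal_cyclic_exists[OF x] .
      then have "cyc b \<in> P" by (auto simp: P_def)
      then show ?thesis using \<open>P = {cyc a}\<close> b(2) by simp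
    qed
    then have "carrier G \<subseteq> cyc a" by blast
    moreover have "a \<in> carrier G" using a by (simp add: maximal_cyclic_def)
    ultimately show False using noncyc cyc_subgroup subgroup.subset by blast
  qed
  moreover have "\<exists>!H. H \<in> P \<and> x \<in> H" if x: "x \<in> carrier G" "x \<noteq> \<one>" for x
  proof -
    obtain a where a: "maximal_cyclic a" "x \<in> cyc a" using maximal_cyclic_exists[OF x(1)] .
    show ?thesis
    proof (rule ex1I[of _ "cyc a"])
      show "cyc a \<in> P \<and> x \<in> cyc a" using a by (auto simp: P_def)
      fix H assume "H \<in> P \<and> x \<in> H"
      then obtain b where "maximal_cyclic b" "H = cyc b" "x \<in> cyc b" by (auto simp: P_def)
      then show "H = cyc a" using disj[OF a(1)] a(2) x(2) by blast
    qed
  qed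
  moreover have "subgroup H G \<and> H \<noteq> {\<one>}" if "H \<in> P" for H
    using that one cyc_subgroup by (auto simp: P_def maximal_cyclic_def)
  ultimately have "nontrivial_partition G P" unfolding nontrivial_partition_def by auto
  then show ?thesis by (auto simp: admits_nontrivial_partition_def)
qed

lemma prime_power_element:
  assumes x: "x \<in> carrier G" "x \<noteq> \<one>"
  obtains z q where "z \<in> cyc x" "z \<noteq> \<one>" "prime q" "z [^] (q :: nat) = \<one>"
proof -
  have "ord x dvd card (cyc x)" using generate_pow_card[OF x(1)] by simp
  have "card (cyc x) \<noteq> 1" using generate_pow_card[OF x(1)] ord_eq_1[OF x(1)] x(2) by simp
  then obtain q where "prime q" "q dvd card (cyc x)" using prime_factor_nat by blast
  then show ?thesis using cauchy[OF cyc_subgroup[OF x(1)]] that by metis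
qed

text \<open>
Induction on the order of \<open>M\<close>: a core of the component of \<open>z\<close> is a core of
\<open>M\<close>. Indeed, if \<open>y\<close> is outside the component and \<open>y^p \<noteq> \<one>\<close>,
then \<open>y\<close> and \<open>y z\<close> have the same \<open>p\<close>-th power and lie in one component,
which also contains \<open>z\<close>.
\<close>
lemma partition_imp_core:
  assumes p: "prime (p :: nat)" and z: "z \<in> carrier G" "z \<noteq> \<one>" "z [^] p = \<one>" "\<And>g. g \<in> carrier G \<Longrightarrow> g \<otimes> z = z \<otimes> g"
    and part: "\<And>H. subgroup H G \<Longrightarrow> H \<noteq> carrier G \<Longrightarrow> \<not> cyclic_group (G\<lparr>carrier := H\<rparr>) \<Longrightarrow>
      admits_nontrivial_partition (G\<lparr>carrier := H\<rparr>)"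
  shows "subgroup M G \<Longrightarrow> M \<noteq> carrier G \<Longrightarrow> z \<in> M \<Longrightarrow>
      \<exists>c\<in>M. z \<in> cyc c \<and> (\<forall>y\<in>M. y \<notin> cyc c \<longrightarrow> y [^] p = \<one>)"
proof (induction "card M" arbitrary: M rule: less_induct)
  case less
  note M = less.prems
  have MG: "M \<subseteq> carrier G" using M(1) subgroup.subset by blast
  show ?case
  proof (cases "cyclic_group (G\<lparr>carrier := M\<rparr>)")
    case True
    then show ?thesis using cyclic_subgroup_iff[OF M(1)] M(3) by blast
  next
    case False
    then obtain P where P: "nontrivial_partition (G\<lparr>carrier := M\<rparr>) P"
      using part[OF M(1,2)] by (auto simp: admits_nontrivial_partition_def)
    obtain K where KP: "K \<in> P" "z \<in> K" using partition_component_exists[OF P M(3) z(2)] .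
    note K = KP(2) partition_component(1,2)[OF M(1) P KP(1)] partition_component_proper[OF M(1) P KP(1)]
    have "card K < card M" using K(3,4) finite_sub[OF MG] by (simp add: psubset_card_mono psubset_eq)
    moreover have "K \<noteq> carrier G" using K(3,4) MG by blast
    ultimately obtain c where c: "c \<in> K" "z \<in> cyc c" "\<And>y. y \<in> K \<Longrightarrow> y \<notin> cyc c \<Longrightarrow> y [^] p = \<one>"
      using less.hyps[OF _ K(2) _ K(1)] by blast
    have "y [^] p = \<one>" if y: "y \<in> M" "y \<notin> K" for y
    proof (rule ccontr)
      assume yp: "y [^] p \<noteq> \<one>"
      have yG: "y \<in> carrier G" using y MG by blast
      have eq: "(y \<otimes> z) [^] p = y [^] p" using pow_mult_commute[OF yG z(1) z(4)[OF yG], of p] z(3) yG by simp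
      have "y [^] p \<in> M" using subgroup_nat_pow_closed[OF M(1) y(1)] .
      then obtain L where L: "L \<in> P" "y [^] p \<in> L" using partition_component_exists[OF P _ yp] by blast
      have "y [^] p \<in> cyc y" using subgroup_nat_pow_closed[OF cyc_subgroup[OF yG] cyc_self] .
      then have yL: "y \<in> L" using partition_component_cyclic[OF M(1) P L(1) y(1) _ L(2) yp] by blast
      have yzG: "y \<otimes> z \<in> carrier G" using yG z(1) by simp
      have "y [^] p \<in> cyc (y \<otimes> z)" using subgroup_nat_pow_closed[OF cyc_subgroup[OF yzG] cyc_self, of p] eq by simp
      moreover have "y \<otimes> z \<in> M" using y M(3) subgroup.m_closed[OF M(1)] by blast
      ultimately have "y \<otimes> z \<in> L" using partition_component_cyclic[OF M(1) P L(1) _ _ L(2) yp] by blast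
      then have "inv y \<otimes> (y \<otimes> z) \<in> L"
        using yL partition_component(1)[OF M(1) P L(1)] by (simp add: subgroup.m_closed subgroup.m_inv_closed)
      then have "z \<in> L" using yG z(1) by (simp add: inv_cancel_left)
      then show False using partition_component_unique[OF M(1) P L(1) KP(1) _ KP(2) z(2)] yL y(2) by blast
    qed
    then show ?thesis using c K(3) by blast
  qed
qed

text \<open>
If the join were proper it would be non-cyclic by maximality, hence partitioned, and the component of the
common element \<open>x\<close> would contain \<open>a\<close> and \<open>b\<close>, hence everything.
\<close>
lemma maximal_cyclic_join:
  assumes part: "\<And>H. subgroup H G \<Longrightarrow> H \<noteq> carrier G \<Longrightarrow> \<not> cyclic_group (G\<lparr>carrier := H\<rparr>) \<Longrightarrow>
      admits_nontrivial_partition (G\<lparr>carrier := H\<rparr>)"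
    and a: "maximal_cyclic a" and b: "maximal_cyclic b" and ne: "cyc a \<noteq> cyc b"
    and x: "x \<in> cyc a" "x \<in> cyc b" "x \<noteq> \<one>"
  shows "generate G {a, b} = carrier G"
proof (rule ccontr)
  let ?U = "generate G {a, b}"
  assume U: "?U \<noteq> carrier G"
  have ab: "a \<in> carrier G" "b \<in> carrier G" using a b by (auto simp: maximal_cyclic_def)
  have sU: "subgroup ?U G" using ab by (simp add: generate_is_subgroup)
  have abU: "a \<in> ?U" "b \<in> ?U" by (simp_all add: generate.incl)
  have "\<not> cyclic_group (G\<lparr>carrier := ?U\<rparr>)"
  proof
    assume "cyclic_group (G\<lparr>carrier := ?U\<rparr>)"
    then obtain c where c: "c \<in> ?U" "?U = cyc c" using cyclic_subgroup_iff[OF sU] by blast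
    have cG: "c \<in> carrier G" using c(1) subgroup.mem_carrier[OF sU] by blast
    have "cyc a \<subseteq> cyc c" "cyc b \<subseteq> cyc c" using cyc_least[OF sU abU(1)] cyc_least[OF sU abU(2)] c(2) by simp_all
    then show False using a b cG ne unfolding maximal_cyclic_def by metis
  qed
  then obtain P where P: "nontrivial_partition (G\<lparr>carrier := ?U\<rparr>) P"
    using part[OF sU U] by (auto simp: admits_nontrivial_partition_def)
  have "x \<in> ?U" using x cyc_least[OF sU abU(1)] by blast
  then obtain K where K: "K \<in> P" "x \<in> K" using partition_component_exists[OF P _ x(3)] by blast
  have "a \<in> K" "b \<in> K" using partition_component_cyclic[OF sU P K(1) _ _ K(2) x(3)] abU x by blast+
  then have "?U \<subseteq> K" using generate_subgroup_incl[OF _ partition_component(1)[OF sU P K(1)]] by simp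
  then show False using partition_component(2)[OF sU P K(1)] partition_component_proper[OF sU P K(1)] by blast
qed

lemma minimal_PF_solvable:
  assumes "minimal_PF_group G" shows "solvable G"
proof (rule ccontr)
  assume "\<not> solvable G"
  then have unsolvable: "\<not> solvable_seq G (carrier G)" by (simp add: solvable_def)
  have nc: "\<not> cyclic_group G" and np: "\<not> admits_nontrivial_partition G"
    and part: "\<And>H. subgroup H G \<Longrightarrow> H \<noteq> carrier G \<Longrightarrow> \<not> cyclic_group (G\<lparr>carrier := H\<rparr>) \<Longrightarrow>
      admits_nontrivial_partition (G\<lparr>carrier := H\<rparr>)"
    using assms by (auto simp: minimal_PF_group_def PF_group_def)
  obtain a b where ab: "maximal_cyclic a" "maximal_cyclic b" "cyc a \<noteq> cyc b" and "\<not> cyc a \<inter> cyc b \<subseteq> {\<one>}"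
    using maximal_cyclic_partition[OF nc] np by blast
  then obtain x where x: "x \<in> cyc a" "x \<in> cyc b" "x \<noteq> \<one>" by blast
  have G: "a \<in> carrier G" "b \<in> carrier G" using ab by (auto simp: maximal_cyclic_def)
  have xG: "x \<in> carrier G" using x(1) subgroup.mem_carrier[OF cyc_subgroup[OF G(1)]] by blast
  obtain z and p :: nat where zx: "z \<in> cyc x" and z: "z \<noteq> \<one>" "prime p" "z [^] p = \<one>" using prime_power_element[OF xG x(3)] .
  have za: "z \<in> cyc a" using zx cyc_least[OF cyc_subgroup[OF G(1)] x(1)] by blast
  have zb: "z \<in> cyc b" using zx cyc_least[OF cyc_subgroup[OF G(2)] x(2)] by blast
  have zG: "z \<in> carrier G" using za subgroup.mem_carrier[OF cyc_subgroup[OF G(1)]] by blast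
  have "a \<in> centralizer z" "b \<in> centralizer z"
    using cyc_commute[OF G(1) za cyc_self] cyc_commute[OF G(2) zb cyc_self] G by (auto simp: centralizer_def)
  then have "generate G {a, b} \<subseteq> centralizer z" using generate_subgroup_incl[OF _ subgroup_centralizer[OF zG]] by simp
  then have central: "g \<otimes> z = z \<otimes> g" if "g \<in> carrier G" for g
    using maximal_cyclic_join[OF part ab x] that by (auto simp: centralizer_def)
  have big: "c [^] p \<noteq> \<one>" if c: "maximal_cyclic c" "z \<in> cyc c" and d: "maximal_cyclic d" "z \<in> cyc d" "cyc c \<noteq> cyc d" for c d
  proof
    assume cp: "c [^] p = \<one>"
    have cG: "c \<in> carrier G" and dG: "d \<in> carrier G" using c d by (auto simp: maximal_cyclic_def)
    obtain k where "c = z [^] (k::nat)" using cyclic_prime_roots[OF cG z(2) c(2) z(1,3) cyc_self cp] .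
    then have "c \<in> cyc d" using subgroup_nat_pow_closed[OF cyc_subgroup[OF dG] d(2)] by simp
    then have "cyc c \<subseteq> cyc d" using cyc_least[OF cyc_subgroup[OF dG]] by blast
    then show False using c(1) d(3) dG unfolding maximal_cyclic_def by metis
  qed
  have ap: "a [^] p \<noteq> \<one>" and bp: "b [^] p \<noteq> \<one>" using big ab za zb by metis+
  have "cored_group G p z"
  proof (intro cored_group.intro cored_group_axioms.intro)
    show "finite_group G" by (rule finite_group_axioms)
    fix c assume c: "c \<in> carrier G" "z \<in> cyc c"
    show "\<exists>y\<in>carrier G. y \<notin> cyc c \<and> y [^] p \<noteq> \<one>"
    proof (rule ccontr)
      assume "\<not> ?thesis"
      then have "a \<in> cyc c" "b \<in> cyc c" using ap bp G by blast+
      then have "cyc a \<subseteq> cyc c" "cyc b \<subseteq> cyc c" using cyc_least[OF cyc_subgroup[OF c(1)]] by blast+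
      then show False using ab c(1) unfolding maximal_cyclic_def by metis
    qed
  qed (use z zG central unsolvable partition_imp_core[OF z(2) zG z(1,3) central part] in blast)+
  then interpret cored_group G p z .
  show False
  proof (cases "p = 2")
    case True
    then interpret even_cored_group G p z by unfold_locales
    show ?thesis by (rule even_contradiction)
  next
    case False
    then have "odd p" using z(2) primes_dvd_imp_eq two_is_prime_nat by blast
    then interpret odd_cored_group G p z by unfold_locales
    show ?thesis by (rule odd_contradiction)
  qed
qed

end


theorem proposition4p3:
  fixes G :: "('a, 'b) monoid_scheme"
  assumes "finite (carrier G)" and "minimal_PF_group G"
  shows "solvable G"
proof -
  have "group G" using assms(2) by (simp add: minimal_PF_group_def PF_group_def)
  then interpret finite_group G
    using assms(1) by (simp add: finite_group_def finite_group_axioms_def)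
  show ?thesis using assms(2) by (rule minimal_PF_solvable)
qed

end
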